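(* Let $f:\mathbb{R}^{n\times n}\to\mathbb{R}$ be convex, differentiable, symmetric, $M$-smooth and $(m,r)$-restricted strongly convex, with $\kappa=M/m$. Let $X^\star$ be a minimizer of $f$ over $\mathbb{S}^n_+$ with $r\le\mathrm{rank}(X^\star)$, let $X^\star_r$ be its best rank-$r$ approximation and $U^\star_r\in\mathbb{R}^{n\times r}$ with $X^\star_r=U^\star_r(U^\star_r)^\top$. Set $\rho'=\frac{1}{100\kappa}\frac{\sigma_r(X^\star)}{\sigma_1(X^\star)}$. Assume: (A2) $U^0\in\mathbb{R}^{n\times r}$ satisfies $\mathrm{Dist}(U^0,U^\star_r)\le\rho'\sigma_r(U^\star_r)$; (A3) $\|X^\star-X^\star_r\|_F\le \frac{1}{200\kappa^{1.5}}\frac{\sigma_r(X^\star)}{\sigma_1(X^\star)}\sigma_r(X^\star)$. Let $X^0=U^0(U^0)^\top$ and $\eta=\frac{1}{16(M\|X^0\|_2+\|\nabla f(X^0)\|_2)}$. Let $U\in\mathbb{R}^{n\times r}$ satisfy $\mathrm{Dist}(U,U^\star_r)\le\rho'\sigma_r(U^\star_r)$, let $X=UU^\top$ and $U^+=U-\eta\nabla f(X)U$. Then $$\mathrm{Dist}(U^+,U^\star_r)^2\le\alpha\,\mathrm{Dist}(U,U^\star_r)^2+\beta\,\|X^\star-X^\star_r\|_F^2,$$ where $\alpha=1-\frac{m\,\sigma_r(X^\star)}{64(M\|X^\star\|_2+\|\nabla f(X^\star)\|_2)}$ and $\beta=\frac{M}{28(M\|X^\star\|_2+\|\nabla f(X^\star)\|_2)}$.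 Furthermore, $\mathrm{Dist}(U^+,U^\star_r)\le\rho'\sigma_r(U^\star_r)$.
   Context: $\mathbb{S}^n_+$ is the cone of $n\times n$ positive semidefinite matrices. For a matrix $A$, $\sigma_i(A)$ is its $i$-th largest singular value, $\|A\|_2=\sigma_1(A)$ and $\|A\|_F$ is the Frobenius norm; $\langle A,B\rangle=\mathrm{tr}(A^\top B)$. For $U,V\in\mathbb{R}^{n\times r}$, $\mathrm{Dist}(U,V)=\min_{R\in\mathcal{O}_r}\|U-VR\|_F$, where $\mathcal{O}_r$ is the set of $r\times r$ orthogonal matrices. $f$ symmetric means $f(X)=f(X^\top)$. $f$ is $M$-smooth if $\|\nabla f(X)-\nabla f(Y)\|_F\le M\|X-Y\|_F$ for all $X,Y\in\mathbb{S}^n_+$. $f$ is $(m,r)$-restricted strongly convex if $f(Y)\ge f(X)+\langle\nabla f(X),Y-X\rangle+\frac m2\|Y-X\|_F^2$ for all $X,Y\in\mathbb{S}^n_+$ of rank at most $r$. The best rank-$r$ approximation of a PSD matrix is given by its truncated eigenvalue decomposition. *)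

theory Defs
  imports "HOL-Analysis.Analysis" "HOL-Library.Multiset"
begin

text \<open>Matrices: an n x k real matrix is a term of type real^'k^'n (rows indexed by 'n).
  The Euclidean norm on real^'k^'n is the Frobenius norm and the inner product is
  the trace inner product tr(A^T B).\<close>

definition psd :: "real^'n^'n \<Rightarrow> bool" where
  "psd A \<longleftrightarrow> transpose A = A \<and> (\<forall>x. 0 \<le> x \<bullet> (A *v x))"

definition grad :: "(real^'n^'m \<Rightarrow> real) \<Rightarrow> real^'n^'m \<Rightarrow> real^'n^'m" where
  "grad f X = (THE D. GDERIV f X :> D)"

definition spec_norm :: "real^'n^'m \<Rightarrow> real" where
  "spec_norm A = onorm (\<lambda>x. A *v x)"

text \<open>Singular values: sigma_i(A) = sqrt of the i-th largest eigenvalue (counted with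
  multiplicity) of the symmetric matrix A^T A; indices start at 1.\<close>
definition eigvals_mset :: "real^'n^'n \<Rightarrow> real multiset" where
  "eigvals_mset S = (\<Sum>c\<in>{c. \<exists>x. x \<noteq> 0 \<and> S *v x = c *\<^sub>R x}.
                        replicate_mset (dim {x. S *v x = c *\<^sub>R x}) c)"

definition sigma :: "real^'n^'m \<Rightarrow> nat \<Rightarrow> real" where
  "sigma A i = sqrt (rev (sorted_list_of_multiset (eigvals_mset (transpose A ** A))) ! (i - 1))"

definition Dist :: "real^'r^'n \<Rightarrow> real^'r^'n \<Rightarrow> real" where
  "Dist U V = Inf {norm (U - V ** R) | R. orthogonal_matrix R}"

definition outer :: "real^'n \<Rightarrow> real^'n \<Rightarrow> real^'n^'n" where
  "outer u v = (\<chi> i j. u $ i * v $ j)"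

text \<open>Xr is a best rank-r approximation of the PSD matrix X obtained by truncating an
  eigenvalue decomposition X = sum_i lambda_i v_i v_i^T (orthonormal v_i, lambda
  nonincreasing) to its r leading terms.\<close>
definition truncated_eig :: "real^'n^'n \<Rightarrow> nat \<Rightarrow> real^'n^'n \<Rightarrow> bool" where
  "truncated_eig X r Xr \<longleftrightarrow>
     (\<exists>(v :: nat \<Rightarrow> real^'n) (lam :: nat \<Rightarrow> real).
        (\<forall>i<CARD('n). \<forall>j<CARD('n). v i \<bullet> v j = (if i = j then 1 else 0)) \<and>
        (\<forall>i j. i \<le> j \<longrightarrow> j < CARD('n) \<longrightarrow> lam j \<le> lam i) \<and>
        X = (\<Sum>i<CARD('n). lam i *\<^sub>R outer (v i) (v i)) \<and>
        Xr = (\<Sum>i<r. lam i *\<^sub>R outer (v i) (v i)))"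

definition M_smooth :: "(real^'n^'n \<Rightarrow> real) \<Rightarrow> real \<Rightarrow> bool" where
  "M_smooth f M \<longleftrightarrow> (\<forall>X Y. psd X \<longrightarrow> psd Y \<longrightarrow>
      norm (grad f X - grad f Y) \<le> M * norm (X - Y))"

definition restricted_strongly_convex :: "(real^'n^'n \<Rightarrow> real) \<Rightarrow> real \<Rightarrow> nat \<Rightarrow> bool" where
  "restricted_strongly_convex f m r \<longleftrightarrow> (\<forall>X Y. psd X \<longrightarrow> psd Y \<longrightarrow> rank X \<le> r \<longrightarrow> rank Y \<le> r \<longrightarrow>
      f Y \<ge> f X + grad f X \<bullet> (Y - X) + m / 2 * (norm (Y - X))\<^sup>2)"

end

theory Submission
  imports Defs
begin

text \<open>
  Let \<open>V = Usr R\<close> with \<open>R\<close> the optimal rotation, \<open>\<Delta> = U - V\<close>, \<open>G\<close> the gradient at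
  \<open>X = U U\<^sup>T\<close> and \<open>N = G U\<close>. Expanding the squared distance of the next iterate from \<open>V\<close> leaves
  the cross term \<open>2 \<langle>N, \<Delta>\<rangle> = \<langle>G, X - Xsr\<rangle> + \<langle>G, \<Delta> \<Delta>\<^sup>T\<rangle>\<close>.

  For the first summand, restricted strong convexity compares \<open>f X\<close> with \<open>f Xsr\<close>; one step
  decreases \<open>f\<close> by at least \<open>\<eta> \<parallel>N\<parallel>\<^sup>2\<close>, never below \<open>f Xs\<close>, and \<open>f Xsr\<close> exceeds \<open>f Xs\<close> by at
  most \<open>M/2 \<parallel>Xs - Xsr\<parallel>\<^sup>2\<close>. Since \<open>V\<^sup>T U\<close> is symmetric at the optimal rotation,
  \<open>\<parallel>X - Xsr\<parallel>\<^sup>2\<close> is at least \<open>\<sigma>\<^sub>r \<parallel>\<Delta>\<parallel>\<^sup>2\<close>.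

  For the second, the gradient at \<open>Xs\<close> is nonnegative on the PSD cone, so
  \<open>- \<langle>G, \<Delta> \<Delta>\<^sup>T\<rangle>\<close> is at most \<open>M \<parallel>X - Xs\<parallel> \<parallel>\<Delta>\<parallel>\<^sup>2\<close>, which is a small multiple of
  \<open>m \<sigma>\<^sub>r \<parallel>\<Delta>\<parallel>\<^sup>2\<close> near \<open>Xs\<close>.
\<close>

section \<open>Matrix norms\<close>

text \<open>As simp rules these would turn \<open>transpose A *v x\<close> into
  \<open>x v* A\<close>; without them every product stays in the form \<open>*v\<close>.\<close>

declare transpose_matrix_vector [simp del] vector_transpose_matrix [simp del]

lemma transpose_add: "transpose (A + B) = transpose A + transpose B"
  by (simp add: transpose_def vec_eq_iff)

lemma transpose_diff: "transpose (A - B) = transpose A - transpose (B :: real^'n^'m)"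
  by (simp add: transpose_def vec_eq_iff)

lemma matrix_mult_diff_left: "A ** (B - C) = A ** B - A ** (C :: real^'k^'n)"
  by (simp add: matrix_matrix_mult_def vec_eq_iff right_diff_distrib sum_subtractf)

lemma matrix_mult_diff_right: "(A - B) ** C = A ** C - B ** (C :: real^'k^'n)"
  by (simp add: matrix_matrix_mult_def vec_eq_iff left_diff_distrib sum_subtractf)

lemma matrix_mult_add_right: "(A + B) ** C = A ** C + B ** (C :: real^'k^'n)"
  by (simp add: matrix_matrix_mult_def vec_eq_iff distrib_right sum.distrib)

lemma matrix_mult_scaleR_left: "(c *\<^sub>R A) ** B = c *\<^sub>R (A ** (B :: real^'k^'n))"
  by (simp add: matrix_matrix_mult_def vec_eq_iff sum_distrib_left mult_ac)

lemma matrix_mult_scaleR_right: "A ** (c *\<^sub>R B) = c *\<^sub>R (A ** (B :: real^'k^'n))"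
  by (simp add: matrix_matrix_mult_def vec_eq_iff sum_distrib_left mult_ac)

lemmas matrix_algebra = transpose_add transpose_diff transpose_scalar matrix_transpose_mul
  matrix_mult_diff_left matrix_mult_diff_right matrix_mult_add_right matrix_add_ldistrib
  matrix_mult_scaleR_left matrix_mult_scaleR_right

lemma inner_transpose_vector: "x \<bullet> (transpose A *v y) = (A *v x) \<bullet> (y :: real^'m)"
  by (metis dot_lmul_matrix inner_commute transpose_matrix_vector)

lemma inner_matrix: "A \<bullet> B = (\<Sum>i\<in>UNIV. \<Sum>j\<in>UNIV. A $ i $ j * B $ i $ j)"
  for A B :: "real^'k^'n"
  by (simp add: inner_vec_def)

lemma inner_transpose: "transpose A \<bullet> transpose B = A \<bullet> B" for A B :: "real^'k^'n"
  unfolding inner_matrix transpose_def by (subst sum.swap) simp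

lemma norm_transpose: "norm (transpose A) = norm A" for A :: "real^'k^'n"
  by (simp add: norm_eq_sqrt_inner inner_transpose)

text \<open>Both sides are the same triple sum. This rule and its left counterpart move factors
  across the trace inner product.\<close>

lemma inner_mult_right: "(A ** B) \<bullet> C = A \<bullet> (C ** transpose B)"
  for A :: "real^'k^'n" and B :: "real^'m^'k"
proof -
  have "(A ** B) \<bullet> C = (\<Sum>i\<in>UNIV. \<Sum>j\<in>UNIV. \<Sum>k\<in>UNIV. A $ i $ k * B $ k $ j * C $ i $ j)"
    by (simp add: inner_matrix matrix_matrix_mult_def sum_distrib_right)
  also have "\<dots> = (\<Sum>i\<in>UNIV. \<Sum>k\<in>UNIV. \<Sum>j\<in>UNIV. A $ i $ k * B $ k $ j * C $ i $ j)"
    by (intro sum.cong refl sum.swap)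
  also have "\<dots> = A \<bullet> (C ** transpose B)"
    by (simp add: inner_matrix matrix_matrix_mult_def transpose_def sum_distrib_left mult_ac)
  finally show ?thesis .
qed

lemma inner_mult_left: "(A ** B) \<bullet> C = B \<bullet> (transpose A ** C)"
  for A :: "real^'k^'n" and B :: "real^'m^'k"
proof -
  have "(A ** B) \<bullet> C = transpose (A ** B) \<bullet> transpose C"
    by (rule inner_transpose[symmetric])
  also have "\<dots> = transpose B \<bullet> transpose (transpose A ** C)"
    by (simp add: matrix_transpose_mul inner_mult_right)
  finally show ?thesis by (simp only: inner_transpose)
qed

lemma norm_matrix_sq: "(norm A)\<^sup>2 = (\<Sum>i\<in>UNIV. (norm (A $ i))\<^sup>2)" for A :: "real^'k^'n"
  by (simp add: norm_vec_def L2_set_def sum_nonneg)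

lemma mult_transpose_row: "(A ** transpose B) $ i = B *v (A $ i)"
  for A :: "real^'k^'n" and B :: "real^'k^'m"
  by (simp add: matrix_matrix_mult_def transpose_def matrix_vector_mult_def vec_eq_iff mult_ac)

text \<open>Each row of \<open>A ** transpose B\<close> is the image under \<open>B\<close> of the
  matching row of \<open>A\<close>, so the vector bound sums over squared rows. A vector bound is
  assumed, rather than \<open>spec_norm B\<close>, so that constants such as \<open>sqrt L\<close>
  can be plugged in directly.\<close>

lemma norm_mult_transpose_le:
  fixes A :: "real^'k^'n" and B :: "real^'k^'m"
  assumes "\<And>x. norm (B *v x) \<le> K * norm x" and "0 \<le> K"
  shows "norm (A ** transpose B) \<le> K * norm A"
proof (rule power2_le_imp_le)
  have "(norm (A ** transpose B))\<^sup>2 = (\<Sum>i\<in>UNIV. (norm (B *v (A $ i)))\<^sup>2)"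
    by (simp add: norm_matrix_sq mult_transpose_row)
  also have "\<dots> \<le> (\<Sum>i\<in>UNIV. (K * norm (A $ i))\<^sup>2)"
    by (intro sum_mono power_mono assms) auto
  also have "\<dots> = (K * norm A)\<^sup>2"
    by (simp add: power_mult_distrib norm_matrix_sq sum_distrib_left)
  finally show "(norm (A ** transpose B))\<^sup>2 \<le> (K * norm A)\<^sup>2" .
qed (use assms in auto)

lemma norm_mult_transpose_ge:
  fixes A :: "real^'k^'n" and B :: "real^'k^'m"
  assumes "\<And>x. c * (norm x)\<^sup>2 \<le> (norm (B *v x))\<^sup>2"
  shows "c * (norm A)\<^sup>2 \<le> (norm (A ** transpose B))\<^sup>2"
  unfolding norm_matrix_sq mult_transpose_row sum_distrib_left by (intro sum_mono assms)

lemma norm_mult_le: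
  fixes A :: "real^'k^'n" and B :: "real^'m^'k"
  assumes "\<And>x. norm (A *v x) \<le> K * norm x" and "0 \<le> K"
  shows "norm (A ** B) \<le> K * norm B"
proof -
  have "norm (A ** B) = norm (transpose B ** transpose A)"
    by (metis matrix_transpose_mul norm_transpose)
  also have "\<dots> \<le> K * norm B"
    using norm_mult_transpose_le[OF assms, of "transpose B"] by (simp add: norm_transpose)
  finally show ?thesis .
qed

lemma norm_matrix_vector_le: "norm (A *v x) \<le> norm A * norm x" for A :: "real^'k^'n"
proof (rule power2_le_imp_le)
  have "(norm (A *v x))\<^sup>2 = (\<Sum>i\<in>UNIV. (A $ i \<bullet> x)\<^sup>2)"
    by (simp add: norm_vec_def L2_set_def sum_nonneg matrix_vector_mul_component)
  also have "\<dots> \<le> (\<Sum>i\<in>UNIV. (norm (A $ i) * norm x)\<^sup>2)"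
    by (intro sum_mono) (metis Cauchy_Schwarz_ineq2 abs_ge_zero power2_abs power_mono)
  also have "\<dots> = (norm A * norm x)\<^sup>2"
    by (simp add: power_mult_distrib norm_matrix_sq sum_distrib_right)
  finally show "(norm (A *v x))\<^sup>2 \<le> (norm A * norm x)\<^sup>2" .
qed simp

lemma norm_mult_submult: "norm (A ** B) \<le> norm A * norm B"
  for A :: "real^'k^'n" and B :: "real^'m^'k"
  by (intro norm_mult_le norm_matrix_vector_le norm_ge_zero)

section \<open>Spectral norm estimates\<close>

lemma spec_norm_vector_le: "norm (A *v x) \<le> spec_norm A * norm x"
  unfolding spec_norm_def by (intro onorm matrix_vector_mul_bounded_linear)

lemma spec_norm_nonneg: "0 \<le> spec_norm A"
  unfolding spec_norm_def by (intro onorm_pos_le matrix_vector_mul_bounded_linear)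

text \<open>The Frobenius norm dominates the spectral norm of \<open>A - B\<close>. This later
  compares the step-size denominators at nearby points.\<close>

lemma spec_norm_le_add: "spec_norm A \<le> spec_norm B + norm (A - B)"
proof -
  have "norm (A *v x) \<le> (spec_norm B + norm (A - B)) * norm x" for x
  proof -
    have "norm (A *v x) = norm (B *v x + (A - B) *v x)"
      by (simp add: matrix_vector_mult_diff_rdistrib)
    also have "\<dots> \<le> norm (B *v x) + norm ((A - B) *v x)" by (rule norm_triangle_ineq)
    also have "\<dots> \<le> spec_norm B * norm x + norm (A - B) * norm x"
      by (intro add_mono spec_norm_vector_le norm_matrix_vector_le)
    finally show ?thesis by (simp add: algebra_simps)
  qed
  then show ?thesis unfolding spec_norm_def[of A] by (intro onorm_le)
qed

lemma norm_transpose_vector_sq: "(norm (transpose U *v x))\<^sup>2 = x \<bullet> ((U ** transpose U) *v x)"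
  for U :: "real^'k^'n"
  by (metis dot_square_norm inner_transpose_vector inner_commute matrix_vector_mul_assoc)

lemma norm_vector_sq: "(norm (U *v x))\<^sup>2 = x \<bullet> ((transpose U ** U) *v x)"
  for U :: "real^'k^'n"
  using norm_transpose_vector_sq[of "transpose U" x] by simp

lemma inner_spec_norm_le: "x \<bullet> (A *v x) \<le> spec_norm A * (norm x)\<^sup>2"
proof -
  have "x \<bullet> (A *v x) \<le> norm x * norm (A *v x)" by (rule norm_cauchy_schwarz)
  also have "\<dots> \<le> norm x * (spec_norm A * norm x)"
    by (intro mult_left_mono spec_norm_vector_le norm_ge_zero)
  finally show ?thesis by (simp add: power2_eq_square mult_ac)
qed

lemma norm_transpose_vector_le:
  fixes U :: "real^'k^'n"
  shows "norm (transpose U *v x) \<le> sqrt (spec_norm (U ** transpose U)) * norm x"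
proof (rule power2_le_imp_le)
  show "(norm (transpose U *v x))\<^sup>2 \<le> (sqrt (spec_norm (U ** transpose U)) * norm x)\<^sup>2"
    using inner_spec_norm_le[of x "U ** transpose U"]
    by (simp add: norm_transpose_vector_sq power_mult_distrib spec_norm_nonneg)
qed (simp add: spec_norm_nonneg)

section \<open>The positive semidefinite cone\<close>

lemma psd_outer_square: "psd (U ** transpose U)" for U :: "real^'k^'n"
  by (simp add: psd_def matrix_transpose_mul norm_transpose_vector_sq[symmetric])

lemma psd_zero: "psd 0"
  by (simp add: psd_def transpose_def vec_eq_iff)

lemma psd_add: "psd A \<Longrightarrow> psd B \<Longrightarrow> psd (A + B)"
  by (simp add: psd_def transpose_add matrix_vector_mult_add_rdistrib inner_add_right)

lemma psd_scaleR: "psd A \<Longrightarrow> 0 \<le> c \<Longrightarrow> psd (c *\<^sub>R A)"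
  by (simp add: psd_def transpose_scalar scaleR_matrix_vector_assoc[symmetric])

lemma rank_outer_square_le: "rank (U ** transpose U) \<le> CARD('k)" for U :: "real^'k^'n"
  using rank_mul_le_left[of U "transpose U"] rank_bound[of U] by simp

section \<open>Spectra from orthonormal eigenbases\<close>

text \<open>Indexed by naturals below the dimension to match \<open>truncated_eig\<close>; values at
  larger indices are unconstrained.\<close>

definition orthonormal_family :: "(nat \<Rightarrow> real^'n) \<Rightarrow> bool" where
  "orthonormal_family v \<longleftrightarrow> (\<forall>i<CARD('n). \<forall>j<CARD('n). v i \<bullet> v j = (if i = j then 1 else 0))"

lemma orthonormal_familyD:
  fixes v :: "nat \<Rightarrow> real^'n"
  shows "orthonormal_family v \<Longrightarrow> i < CARD('n) \<Longrightarrow> j < CARD('n) \<Longrightarrow> v i \<bullet> v j = (if i = j then 1 else 0)"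
  by (simp add: orthonormal_family_def)

lemma orthonormal_family_inj_on:
  fixes v :: "nat \<Rightarrow> real^'n"
  assumes "orthonormal_family v"
  shows "inj_on v {..<CARD('n)}"
proof (rule inj_onI)
  fix i j assume *: "i \<in> {..<CARD('n)}" "j \<in> {..<CARD('n)}" "v i = v j"
  then have "v i \<bullet> v j = 1" using orthonormal_familyD[OF assms, of j j] by simp
  then show "i = j" using * orthonormal_familyD[OF assms, of i j] by (auto split: if_splits)
qed

lemma orthonormal_family_independent:
  fixes v :: "nat \<Rightarrow> real^'n"
  assumes v: "orthonormal_family v" and I: "I \<subseteq> {..<CARD('n)}"
  shows "independent (v ` I)"
proof (rule pairwise_orthogonal_independent)
  show "pairwise orthogonal (v ` I)"
  proof -
    have "v i \<bullet> v j = 0" if "i \<in> I" "j \<in> I" "v i \<noteq> v j" for i j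
      using orthonormal_familyD[OF v, of i j] subsetD[OF I that(1)] subsetD[OF I that(2)] that(3) by auto
    then show ?thesis by (auto simp: pairwise_def orthogonal_def)
  qed
  show "0 \<notin> v ` I"
  proof
    assume "0 \<in> v ` I"
    then obtain i where "i \<in> I" "v i = 0" by force
    then show False using orthonormal_familyD[OF v, of i i] I by auto
  qed
qed

text \<open>\<open>CARD('n)\<close> independent vectors span the whole space, so the residual lies
  in the span while being orthogonal to it, hence to itself.\<close>

lemma orthonormal_family_expand:
  fixes v :: "nat \<Rightarrow> real^'n"
  assumes v: "orthonormal_family v"
  shows "x = (\<Sum>i<CARD('n). (v i \<bullet> x) *\<^sub>R v i)"
proof -
  let ?y = "x - (\<Sum>i<CARD('n). (v i \<bullet> x) *\<^sub>R v i)"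
  have "span (v ` {..<CARD('n)}) = UNIV"
  proof -
    have "card (v ` {..<CARD('n)}) = dim (UNIV :: (real^'n) set)"
      by (simp add: card_image[OF orthonormal_family_inj_on[OF v]])
    then show ?thesis
      using card_eq_dim[of "v ` {..<CARD('n)}" UNIV] orthonormal_family_independent[OF v order_refl]
      by auto
  qed
  then have "?y \<in> span (v ` {..<CARD('n)})" by simp
  moreover have "orthogonal ?y z" if z: "z \<in> v ` {..<CARD('n)}" for z
  proof -
    obtain j where j: "j < CARD('n)" "z = v j" using z by auto
    have "(\<Sum>i<CARD('n). (v i \<bullet> x) *\<^sub>R v i) \<bullet> v j = (\<Sum>i<CARD('n). if i = j then v j \<bullet> x else 0)"
      unfolding inner_sum_left by (intro sum.cong) (use j orthonormal_familyD[OF v] in auto)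
    then show ?thesis using j by (simp add: orthogonal_def inner_diff_left) (simp add: inner_commute)
  qed
  ultimately have "orthogonal ?y ?y" by (rule orthogonal_to_span)
  then show ?thesis by (simp add: orthogonal_self)
qed

lemma orthonormal_family_norm_sq:
  fixes v :: "nat \<Rightarrow> real^'n"
  assumes v: "orthonormal_family v"
  shows "(norm x)\<^sup>2 = (\<Sum>i<CARD('n). (v i \<bullet> x)\<^sup>2)"
proof -
  have "(norm x)\<^sup>2 = x \<bullet> (\<Sum>i<CARD('n). (v i \<bullet> x) *\<^sub>R v i)"
    by (subst orthonormal_family_expand[OF v, symmetric]) (simp add: dot_square_norm)
  then show ?thesis by (simp add: inner_sum_right power2_eq_square inner_commute)
qed

lemma eigenbasis_quadratic_form:
  fixes S :: "real^'n^'n"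
  assumes v: "orthonormal_family v" and S: "\<And>i. i < CARD('n) \<Longrightarrow> S *v v i = mu i *\<^sub>R v i"
  shows "x \<bullet> (S *v x) = (\<Sum>i<CARD('n). mu i * (v i \<bullet> x)\<^sup>2)"
proof -
  have "S *v x = S *v (\<Sum>i<CARD('n). (v i \<bullet> x) *\<^sub>R v i)"
    by (subst orthonormal_family_expand[OF v, symmetric]) simp
  also have "\<dots> = (\<Sum>i<CARD('n). (v i \<bullet> x) *\<^sub>R (S *v v i))"
    by (simp add: linear_sum[OF matrix_vector_mul_linear] matrix_vector_mult_scaleR)
  also have "\<dots> = (\<Sum>i<CARD('n). ((v i \<bullet> x) * mu i) *\<^sub>R v i)"
    by (intro sum.cong) (auto simp: S)
  finally show ?thesis
    by (simp add: inner_sum_right power2_eq_square inner_commute mult_ac)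
qed

lemma inner_eigenbasis:
  fixes S :: "real^'n^'n"
  assumes v: "orthonormal_family v" and S: "\<And>i. i < CARD('n) \<Longrightarrow> S *v v i = mu i *\<^sub>R v i"
    and j: "j < CARD('n)"
  shows "v j \<bullet> (S *v x) = mu j * (v j \<bullet> x)"
proof -
  have "S *v x = S *v (\<Sum>i<CARD('n). (v i \<bullet> x) *\<^sub>R v i)"
    by (subst orthonormal_family_expand[OF v, symmetric]) simp
  also have "\<dots> = (\<Sum>i<CARD('n). (v i \<bullet> x) *\<^sub>R (S *v v i))"
    by (simp add: linear_sum[OF matrix_vector_mul_linear] matrix_vector_mult_scaleR)
  finally have "v j \<bullet> (S *v x) = (\<Sum>i<CARD('n). (v i \<bullet> x) * (v j \<bullet> (S *v v i)))"
    by (simp add: inner_sum_right)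
  also have "\<dots> = (\<Sum>i<CARD('n). if i = j then mu j * (v j \<bullet> x) else 0)"
    by (intro sum.cong) (use j in \<open>auto simp: S orthonormal_familyD[OF v]\<close>)
  finally show ?thesis using j by simp
qed

text \<open>If \<open>x\<close> is in the eigenspace of \<open>c\<close>, comparing coordinates
  gives \<open>mu i * (v i \<bullet> x) = c * (v i \<bullet> x)\<close>, so only basis vectors with
  eigenvalue \<open>c\<close> contribute.\<close>

lemma eigenspace_eq_span:
  fixes S :: "real^'n^'n"
  assumes v: "orthonormal_family v" and S: "\<And>i. i < CARD('n) \<Longrightarrow> S *v v i = mu i *\<^sub>R v i"
  shows "{x. S *v x = c *\<^sub>R x} = span (v ` {i. i < CARD('n) \<and> mu i = c})"
proof (intro equalityI subsetI)
  fix x assume x: "x \<in> {x. S *v x = c *\<^sub>R x}"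
  have 0: "v i \<bullet> x = 0" if "i < CARD('n)" "mu i \<noteq> c" for i
    using inner_eigenbasis[OF v S that(1), of x] x that by simp
  have "x = (\<Sum>i<CARD('n). (v i \<bullet> x) *\<^sub>R v i)" by (rule orthonormal_family_expand[OF v])
  also have "\<dots> \<in> span (v ` {i. i < CARD('n) \<and> mu i = c})"
  proof (rule span_sum)
    fix i assume "i \<in> {..<CARD('n)}"
    then show "(v i \<bullet> x) *\<^sub>R v i \<in> span (v ` {i. i < CARD('n) \<and> mu i = c})"
      by (cases "mu i = c") (auto simp: 0 span_zero intro!: span_scale intro: span_base)
  qed
  finally show "x \<in> span (v ` {i. i < CARD('n) \<and> mu i = c})" .
next
  have "span (v ` {i. i < CARD('n) \<and> mu i = c}) \<subseteq> {x. S *v x = c *\<^sub>R x}"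
  proof (rule span_minimal)
    show "subspace {x. S *v x = c *\<^sub>R x}"
      by (auto simp: subspace_def matrix_vector_right_distrib scaleR_add_right matrix_vector_mult_scaleR)
  qed (auto simp: S)
  then show "\<And>x. x \<in> span (v ` {i. i < CARD('n) \<and> mu i = c}) \<Longrightarrow> x \<in> {x. S *v x = c *\<^sub>R x}"
    by blast
qed

text \<open>The dimension of each eigenspace is the number of indices carrying that eigenvalue,
  which is its count in the list of the \<open>mu i\<close>.\<close>

lemma eigvals_mset_eigenbasis:
  fixes S :: "real^'n^'n"
  assumes v: "orthonormal_family v" and S: "\<And>i. i < CARD('n) \<Longrightarrow> S *v v i = mu i *\<^sub>R v i"
  shows "eigvals_mset S = mset (map mu [0..<CARD('n)])"
proof -
  let ?I = "\<lambda>c. {i. i < CARD('n) \<and> mu i = c}"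
  have dim: "dim {x. S *v x = c *\<^sub>R x} = card (?I c)" for c
  proof -
    have "independent (v ` ?I c)" by (rule orthonormal_family_independent[OF v]) auto
    moreover have "card (v ` ?I c) = card (?I c)"
      by (rule card_image, rule inj_on_subset[OF orthonormal_family_inj_on[OF v]]) auto
    ultimately show ?thesis
      by (simp add: eigenspace_eq_span[OF v S] dim_eq_card_independent)
  qed
  have C: "{c. \<exists>x. x \<noteq> 0 \<and> S *v x = c *\<^sub>R x} = mu ` {..<CARD('n)}"
  proof (intro equalityI subsetI)
    fix c assume "c \<in> {c. \<exists>x. x \<noteq> 0 \<and> S *v x = c *\<^sub>R x}"
    then obtain x where "x \<noteq> 0" "x \<in> span (v ` ?I c)"
      using eigenspace_eq_span[OF v S, of c] by auto
    then have "?I c \<noteq> {}" by (auto simp del: Collect_empty_eq)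
    then show "c \<in> mu ` {..<CARD('n)}" by auto
  next
    fix c assume "c \<in> mu ` {..<CARD('n)}"
    then obtain i where i: "i < CARD('n)" "c = mu i" by auto
    then have "v i \<noteq> 0" using orthonormal_familyD[OF v, of i i] by auto
    then show "c \<in> {c. \<exists>x. x \<noteq> 0 \<and> S *v x = c *\<^sub>R x}" using i S by auto
  qed
  show ?thesis
  proof (rule multiset_eqI)
    fix a
    have "count (eigvals_mset S) a = (\<Sum>c\<in>mu ` {..<CARD('n)}. if c = a then card (?I c) else 0)"
      unfolding eigvals_mset_def C count_sum dim by (intro sum.cong) auto
    \<comment> \<open>If \<open>a\<close> is not an eigenvalue, the sum vanishes and
      \<open>?I a\<close> is empty, so both sides are zero.\<close>
    also have "\<dots> = card (?I a)"
      by (auto simp: sum.delta' intro!: card_gt_0_iff[THEN iffD2] simp: card_eq_0_iff)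
    also have "\<dots> = count (mset (map mu [0..<CARD('n)])) a"
    proof -
      have "count (mset (map mu [0..<CARD('n)])) a = (\<Sum>i\<in>?I a. 1)"
        unfolding mset_map mset_upt by (subst count_image_mset') (intro sum.cong, auto)
      then show ?thesis by simp
    qed
    finally show "count (eigvals_mset S) a = count (mset (map mu [0..<CARD('n)])) a" .
  qed
qed

text \<open>Makes \<open>sigma\<close> computable from eigenpairs: as \<open>mu\<close> is
  nonincreasing, the reversed sorted list is \<open>mu 0, mu 1, ...\<close>, and
  \<open>k - 1\<close> appears because \<open>sigma\<close> counts from one.\<close>

lemma sigma_eigenbasis:
  fixes A :: "real^'n^'m"
  assumes v: "orthonormal_family v"
    and A: "\<And>i. i < CARD('n) \<Longrightarrow> (transpose A ** A) *v v i = mu i *\<^sub>R v i"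
    and mono: "\<And>i j. i \<le> j \<Longrightarrow> j < CARD('n) \<Longrightarrow> mu j \<le> mu i"
    and k: "1 \<le> k" "k \<le> CARD('n)"
  shows "sigma A k = sqrt (mu (k - 1))"
proof -
  have "sorted (rev (map mu [0..<CARD('n)]))"
    by (auto simp: sorted_iff_nth_mono_less rev_nth intro!: mono)
  then have "sort (map mu [0..<CARD('n)]) = rev (map mu [0..<CARD('n)])"
    by (intro properties_for_sort) auto
  moreover have "eigvals_mset (transpose A ** A) = mset (map mu [0..<CARD('n)])"
    by (rule eigvals_mset_eigenbasis[OF v A])
  ultimately show ?thesis
    unfolding sigma_def using k by (simp only: sorted_list_of_multiset_mset) simp
qed

section \<open>The orthogonal Procrustes distance\<close>

text \<open>Unit rows fix the Frobenius norm, giving boundedness; the polynomial equations of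
  orthonormal columns give closedness.\<close>

lemma compact_orthogonal_matrices: "compact {R :: real^'k^'k. orthogonal_matrix R}"
proof (rule compact_eq_bounded_closed[THEN iffD2], intro conjI)
  have "norm R \<le> sqrt (real CARD('k))" if "orthogonal_matrix R" for R :: "real^'k^'k"
  proof -
    have "norm (R $ i) = 1" for i
      using that unfolding orthogonal_matrix_orthonormal_rows row_def
      by (simp add: vec_lambda_eta)
    then have "(norm R)\<^sup>2 = real CARD('k)" by (simp add: norm_matrix_sq)
    then show ?thesis by (metis norm_ge_zero order_refl real_sqrt_unique)
  qed
  then show "bounded {R :: real^'k^'k. orthogonal_matrix R}"
    by (auto simp: bounded_iff)
  have "{R :: real^'k^'k. orthogonal_matrix R} =
      {R. \<forall>i j. (\<Sum>k\<in>UNIV. R $ k $ i * R $ k $ j) = (mat 1 :: real^'k^'k) $ i $ j}"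
    by (auto simp: orthogonal_matrix vec_eq_iff matrix_matrix_mult_def transpose_def)
  moreover have "closed \<dots>"
    by (intro closed_Collect_all closed_Collect_eq continuous_intros)
  ultimately show "closed {R :: real^'k^'k. orthogonal_matrix R}" by simp
qed

lemma Dist_le: "orthogonal_matrix R \<Longrightarrow> Dist U V \<le> norm (U - V ** R)"
  unfolding Dist_def by (rule cInf_lower) (auto intro: bdd_belowI[of _ 0])

text \<open>By compactness the infimum in \<open>Dist\<close> is a minimum; the identity matrix
  shows that the set of competitors is nonempty.\<close>

lemma Dist_attained:
  obtains R where "orthogonal_matrix R" "Dist U V = norm (U - V ** R)"
proof -
  have "continuous_on {R. orthogonal_matrix R} (\<lambda>R. norm (U - V ** R))"
    unfolding matrix_matrix_mult_def by (intro continuous_intros)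
  then obtain R where R: "orthogonal_matrix R"
      "\<And>Q. orthogonal_matrix Q \<Longrightarrow> norm (U - V ** R) \<le> norm (U - V ** Q)"
    using continuous_attains_inf[OF compact_orthogonal_matrices]
    by (metis (no_types, lifting) empty_iff mem_Collect_eq orthogonal_matrix_id)
  have "norm (U - V ** R) \<le> Dist U V"
    unfolding Dist_def by (rule cInf_greatest) (use R in auto)
  then show thesis using that R(1) Dist_le[OF R(1), of U V] by force
qed

text \<open>For cosine \<open>c\<close> and sine \<open>s\<close>, the rotation of the coordinate
  plane of \<open>p\<close> and \<open>q\<close> that fixes the other coordinates.\<close>

definition givens :: "'k \<Rightarrow> 'k \<Rightarrow> real \<Rightarrow> real \<Rightarrow> real^'k^'k" where
  "givens p q c s = (\<chi> i j. if i = p then (if j = p then c else if j = q then s else 0)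
     else if i = q then (if j = p then - s else if j = q then c else 0)
     else if i = j then 1 else 0)"

lemma orthogonal_matrix_givens:
  assumes "p \<noteq> q" and "c\<^sup>2 + s\<^sup>2 = 1"
  shows "orthogonal_matrix (givens p q c s)"
proof -
  have split: "(\<Sum>k\<in>UNIV. h k) = h p + h q + (\<Sum>k\<in>UNIV - {p, q}. h k)" for h :: "'a \<Rightarrow> real"
    using assms(1) by (subst sum.subset_diff[of "{p, q}"]) auto
  have "(\<Sum>k\<in>UNIV. givens p q c s $ k $ i * givens p q c s $ k $ j) = (if i = j then 1 else 0)" for i j
  proof -
    have "(\<Sum>k\<in>UNIV - {p, q}. givens p q c s $ k $ i * givens p q c s $ k $ j) =
        (\<Sum>k\<in>UNIV - {p, q}. if k = i then (if i = j then 1 else 0) else 0)"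
      by (intro sum.cong) (auto simp: givens_def)
    also have "\<dots> = (if i \<in> {p, q} then 0 else if i = j then 1 else 0)"
      by (simp add: sum.delta)
    finally show ?thesis
      using assms unfolding split by (auto simp: givens_def power2_eq_square algebra_simps)
  qed
  then show ?thesis
    by (simp add: orthogonal_matrix vec_eq_iff matrix_matrix_mult_def transpose_def mat_def)
qed

text \<open>The rotation differs from the identity only in a 2 x 2 block. The asymmetry of
  \<open>A\<close> enters with the sine, so it dominates for small angles.\<close>

lemma inner_givens:
  fixes A :: "real^'k^'k"
  assumes "p \<noteq> q"
  shows "A \<bullet> givens p q c s - A \<bullet> mat 1 = (c - 1) * (A $ p $ p + A $ q $ q) + s * (A $ p $ q - A $ q $ p)"
proof -
  have split: "(\<Sum>k\<in>UNIV. h k) = h p + h q + (\<Sum>k\<in>UNIV - {p, q}. h k)" for h :: "'k \<Rightarrow> real"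
    using assms(1) by (subst sum.subset_diff[of "{p, q}"]) auto
  define E where "E = givens p q c s - mat 1"
  have E: "E $ i $ j = (if i = p then (if j = p then c - 1 else if j = q then s else 0)
     else if i = q then (if j = p then - s else if j = q then c - 1 else 0) else 0)" for i j
    using assms by (auto simp: E_def givens_def mat_def)
  have "A \<bullet> E = (\<Sum>i\<in>UNIV. A $ i $ p * E $ i $ p + A $ i $ q * E $ i $ q)"
    unfolding inner_matrix by (intro sum.cong refl, subst split) (auto simp: E intro!: sum.neutral split: if_splits)
  also have "\<dots> = (A $ p $ p * E $ p $ p + A $ p $ q * E $ p $ q) + (A $ q $ p * E $ q $ p + A $ q $ q * E $ q $ q)"
    by (subst split) (auto simp: E intro!: sum.neutral)
  finally show ?thesis using assms by (simp add: E_def[symmetric] inner_diff_right[symmetric] E algebra_simps)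
qed

text \<open>First-order optimality over the Givens rotations forces symmetry.\<close>

lemma symmetric_if_trace_maximal:
  fixes A :: "real^'k^'k"
  assumes max: "\<And>Q. orthogonal_matrix Q \<Longrightarrow> A \<bullet> Q \<le> A \<bullet> mat 1"
  shows "transpose A = A"
proof -
  have "A $ p $ q = A $ q $ p" if pq: "p \<noteq> q" for p q
  proof (rule ccontr)
    assume ne: "A $ p $ q \<noteq> A $ q $ p"
    define a where "a = A $ p $ p + A $ q $ q"
    define b where "b = A $ p $ q - A $ q $ p"
    \<comment> \<open>\<open>t\<close> is the tangent of the half angle, giving a rational cosine
      and sine. Maximality yields \<open>t * b\<close> \<le> \<open>t\<^sup>2 * a\<close>, while
      this \<open>t\<close> satisfies \<open>t * b = t\<^sup>2 * (\<bar>a\<bar> + 1)\<close>, which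
      is strictly larger.\<close>
    define t where "t = b / (\<bar>a\<bar> + 1)"
    have "(1 - t\<^sup>2)\<^sup>2 + (2 * t)\<^sup>2 = (1 + t\<^sup>2)\<^sup>2" by algebra
    moreover have pos: "0 < 1 + t\<^sup>2" by (simp add: add_pos_nonneg)
    ultimately have "((1 - t\<^sup>2) / (1 + t\<^sup>2))\<^sup>2 + (2 * t / (1 + t\<^sup>2))\<^sup>2 = 1"
      by (simp add: power_divide add_divide_distrib[symmetric])
    then have "A \<bullet> givens p q ((1 - t\<^sup>2) / (1 + t\<^sup>2)) (2 * t / (1 + t\<^sup>2)) \<le> A \<bullet> mat 1"
      by (intro max orthogonal_matrix_givens pq)
    then have "((1 - t\<^sup>2) / (1 + t\<^sup>2) - 1) * a + 2 * t / (1 + t\<^sup>2) * b \<le> 0"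
      using inner_givens[OF pq, of A] unfolding a_def b_def by (smt (verit))
    moreover have "(1 - t\<^sup>2) / (1 + t\<^sup>2) - 1 = - 2 * t\<^sup>2 / (1 + t\<^sup>2)"
      using pos by (simp add: field_simps)
    ultimately have "(- 2 * t\<^sup>2 * a + 2 * t * b) / (1 + t\<^sup>2) \<le> 0"
      by (simp add: add_divide_distrib diff_divide_distrib)
    then have le: "t * b \<le> t\<^sup>2 * a" using pos by (simp add: divide_le_0_iff)
    have b: "b = t * (\<bar>a\<bar> + 1)" unfolding t_def by simp
    have "t \<noteq> 0" using ne unfolding t_def b_def by simp
    have "t * b = t\<^sup>2 * (\<bar>a\<bar> + 1)" by (subst b) (simp add: power2_eq_square)
    also have "\<dots> > t\<^sup>2 * a" using \<open>t \<noteq> 0\<close> by (intro mult_strict_left_mono) auto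
    finally show False using le by simp
  qed
  then show ?thesis by (simp add: transpose_def vec_eq_iff) metis
qed

lemma orthogonal_matrix_mult_transpose:
  fixes V :: "real^'k^'n"
  assumes "orthogonal_matrix R"
  shows "(V ** R) ** transpose (V ** R) = V ** transpose V"
proof -
  have "(V ** R) ** transpose (V ** R) = V ** (R ** transpose R) ** transpose V"
    by (simp add: matrix_transpose_mul matrix_mul_assoc)
  then show ?thesis using assms by (simp add: orthogonal_matrix_def)
qed

text \<open>With \<open>W = V ** R\<close> optimal, \<open>W ** Q\<close> is another competitor of
  the same norm as \<open>W\<close>. Expanding the squares shows that \<open>Q = mat 1\<close>
  maximizes the inner product of \<open>transpose W ** U\<close> with \<open>Q\<close>, which forces
  symmetry.\<close>

lemma Dist_attained_symmetric:
  fixes U V :: "real^'k^'n"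
  obtains R where "orthogonal_matrix R" "Dist U V = norm (U - V ** R)"
    "transpose (transpose (V ** R) ** U) = transpose (V ** R) ** U"
proof -
  obtain R where R: "orthogonal_matrix R" "Dist U V = norm (U - V ** R)" by (rule Dist_attained)
  define W where "W = V ** R"
  have "transpose (transpose W ** U) = transpose W ** U"
  proof (rule symmetric_if_trace_maximal)
    fix Q :: "real^'k^'k" assume Q: "orthogonal_matrix Q"
    have inn: "(transpose W ** U) \<bullet> P = U \<bullet> (W ** P)" for P
      by (simp add: inner_mult_left)
    have "norm (U - W) \<le> norm (U - W ** Q)"
      using Dist_le[OF orthogonal_matrix_mul[OF R(1) Q], of U V] R(2)
      by (simp add: W_def matrix_mul_assoc)
    then have "(norm (U - W))\<^sup>2 \<le> (norm (U - W ** Q))\<^sup>2" by (intro power_mono) auto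
    moreover have "(norm (W ** Q))\<^sup>2 = (norm W)\<^sup>2"
    proof -
      have "(W ** Q) \<bullet> (W ** Q) = W \<bullet> (W ** (Q ** transpose Q))"
        by (simp add: inner_mult_right matrix_mul_assoc)
      then show ?thesis using Q by (simp add: orthogonal_matrix_def dot_square_norm)
    qed
    ultimately have "U \<bullet> (W ** Q) \<le> U \<bullet> W"
      by (simp add: power2_norm_eq_inner inner_diff inner_commute)
    then show "(transpose W ** U) \<bullet> Q \<le> (transpose W ** U) \<bullet> mat 1"
      by (simp add: inn)
  qed
  then show thesis using that R unfolding W_def by blast
qed

section \<open>Gradients and first-order optimality\<close>

text \<open>Riesz representation of the derivative in the standard basis; uniqueness of the
  representing matrix resolves the definite description in \<open>grad\<close>.\<close>

lemma GDERIV_grad: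
  fixes f :: "real^'k^'n \<Rightarrow> real"
  assumes "f differentiable (at X)"
  shows "GDERIV f X :> grad f X"
proof -
  obtain f' where f': "(f has_derivative f') (at X)"
    using assms unfolding differentiable_def by blast
  interpret f': bounded_linear f' using f' by (rule has_derivative_bounded_linear)
  define D where "D = (\<Sum>b\<in>Basis. f' b *\<^sub>R b)"
  have "f' = (\<lambda>h. h \<bullet> D)"
  proof
    fix h
    have "f' h = f' (\<Sum>b\<in>Basis. (h \<bullet> b) *\<^sub>R b)" by (simp add: euclidean_representation)
    also have "\<dots> = h \<bullet> D" by (simp add: f'.sum f'.scaleR D_def inner_sum_right mult.commute)
    finally show "f' h = h \<bullet> D" .
  qed
  then have "GDERIV f X :> D" using f' by (simp add: gderiv_def)
  moreover have "E = D" if "GDERIV f X :> E" for E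
  proof -
    have "(\<lambda>h. h \<bullet> E) = (\<lambda>h. h \<bullet> D)"
      using that \<open>GDERIV f X :> D\<close> unfolding gderiv_def by (rule has_derivative_unique)
    then show ?thesis by (simp add: fun_eq_iff vector_eq_ldot)
  qed
  ultimately show ?thesis unfolding grad_def by (metis theI)
qed

lemma grad_unique:
  fixes f :: "real^'k^'n \<Rightarrow> real"
  assumes "GDERIV f X :> D"
  shows "grad f X = D"
proof -
  have "f differentiable (at X)" using assms unfolding gderiv_def differentiable_def by blast
  then have "(\<lambda>h. h \<bullet> grad f X) = (\<lambda>h. h \<bullet> D)"
    using GDERIV_grad assms unfolding gderiv_def by (blast intro: has_derivative_unique)
  then show ?thesis by (simp add: fun_eq_iff vector_eq_ldot)
qed

text \<open>Differentiating \<open>f \<circ> transpose = f\<close> at the fixed point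
  \<open>X\<close> makes the transposed gradient a gradient as well; uniqueness identifies the
  two.\<close>

lemma grad_symmetric:
  fixes f :: "real^'n^'n \<Rightarrow> real"
  assumes diff: "f differentiable (at X)" and symm: "\<And>Y. f Y = f (transpose Y)"
    and X: "transpose X = X"
  shows "transpose (grad f X) = grad f X"
proof -
  have lin: "linear (transpose :: real^'n^'n \<Rightarrow> real^'n^'n)"
    by (rule linearI) (simp_all add: transpose_add transpose_scalar)
  have "(f has_derivative (\<lambda>h. h \<bullet> grad f X)) (at (transpose X))"
    using GDERIV_grad[OF diff] X unfolding gderiv_def by simp
  then have "(f \<circ> transpose has_derivative (\<lambda>h. h \<bullet> grad f X) \<circ> transpose) (at X)"
    by (intro diff_chain_at linear_imp_has_derivative lin)
  moreover have "f \<circ> transpose = f" using symm by auto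
  moreover have "(\<lambda>h. h \<bullet> grad f X) \<circ> transpose = (\<lambda>h. h \<bullet> transpose (grad f X))"
    using inner_transpose[of _ "transpose (grad f X)"] by (simp add: fun_eq_iff)
  ultimately have "GDERIV f X :> transpose (grad f X)" unfolding gderiv_def by simp
  then show ?thesis using grad_unique by metis
qed

lemma DERIV_along_line:
  fixes f :: "real^'k^'n \<Rightarrow> real"
  assumes "f differentiable (at (X + t *\<^sub>R H))"
  shows "((\<lambda>t. f (X + t *\<^sub>R H)) has_real_derivative grad f (X + t *\<^sub>R H) \<bullet> H) (at t)"
proof -
  have "((\<lambda>t. X + t *\<^sub>R H) has_derivative (\<lambda>h. h *\<^sub>R H)) (at t)"
    by (auto intro!: derivative_eq_intros)
  from diff_chain_at[OF this, of f] GDERIV_grad[OF assms]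
  have "((\<lambda>t. f (X + t *\<^sub>R H)) has_derivative (\<lambda>h. (h *\<^sub>R H) \<bullet> grad f (X + t *\<^sub>R H))) (at t)"
    unfolding gderiv_def o_def by blast
  then show ?thesis
    by (rule has_derivative_imp_has_field_derivative) (simp add: inner_commute)
qed

text \<open>Along the segment, \<open>\<phi>\<close> is \<open>f\<close> minus its quadratic upper
  model, up to a constant, and smoothness makes its derivative nonpositive.\<close>

lemma descent_lemma:
  fixes f :: "real^'n^'n \<Rightarrow> real"
  assumes diff: "\<And>X. f differentiable (at X)" and smooth: "M_smooth f M"
    and X: "psd X" and Y: "psd Y"
  shows "f Y \<le> f X + grad f X \<bullet> (Y - X) + M / 2 * (norm (Y - X))\<^sup>2"
proof -
  define H where "H = Y - X"
  define \<phi> where "\<phi> t = f (X + t *\<^sub>R H) - t * (grad f X \<bullet> H) - M / 2 * t\<^sup>2 * (norm H)\<^sup>2" for t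
  have "\<phi> 1 \<le> \<phi> 0"
  proof (rule DERIV_nonpos_imp_nonincreasing[where f = \<phi>])
    fix t :: real assume t: "0 \<le> t" "t \<le> 1"
    let ?D = "grad f (X + t *\<^sub>R H) \<bullet> H - grad f X \<bullet> H - M * t * (norm H)\<^sup>2"
    have "(\<phi> has_real_derivative ?D) (at t)"
      unfolding \<phi>_def by (auto intro!: derivative_eq_intros DERIV_along_line diff)
    moreover have "?D \<le> 0"
    proof -
      \<comment> \<open>\<open>M_smooth\<close> speaks only of the PSD cone, so the segment is
        written as a convex combination to stay inside it.\<close>
      have "X + t *\<^sub>R H = (1 - t) *\<^sub>R X + t *\<^sub>R Y" by (simp add: H_def algebra_simps)
      then have "psd (X + t *\<^sub>R H)" using t by (simp add: psd_add psd_scaleR X Y)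
      then have "norm (grad f (X + t *\<^sub>R H) - grad f X) \<le> M * norm (X + t *\<^sub>R H - X)"
        using smooth X unfolding M_smooth_def by blast
      then have g: "norm (grad f (X + t *\<^sub>R H) - grad f X) \<le> M * t * norm H" using t by simp
      have "grad f (X + t *\<^sub>R H) \<bullet> H - grad f X \<bullet> H = (grad f (X + t *\<^sub>R H) - grad f X) \<bullet> H"
        by (simp add: inner_diff_left)
      also have "\<dots> \<le> norm (grad f (X + t *\<^sub>R H) - grad f X) * norm H" by (rule norm_cauchy_schwarz)
      also have "\<dots> \<le> M * t * norm H * norm H" by (intro mult_right_mono g) auto
      finally show ?thesis by (simp add: power2_eq_square)
    qed
    ultimately show "\<exists>y. (\<phi> has_real_derivative y) (at t) \<and> y \<le> 0" by blast
  qed simp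
  then show ?thesis by (simp add: \<phi>_def H_def)
qed

text \<open>The ray from \<open>X\<close> in direction \<open>P\<close> stays in the cone, so a
  negative directional derivative would contradict minimality.\<close>

lemma grad_psd_minimizer_nonneg:
  fixes f :: "real^'n^'n \<Rightarrow> real"
  assumes diff: "f differentiable (at X)" and X: "psd X" and min: "\<And>Y. psd Y \<Longrightarrow> f X \<le> f Y"
    and P: "psd P"
  shows "0 \<le> grad f X \<bullet> P"
proof (rule ccontr)
  assume neg: "\<not> 0 \<le> grad f X \<bullet> P"
  have "((\<lambda>t. f (X + t *\<^sub>R P)) has_real_derivative grad f X \<bullet> P) (at 0)"
    using DERIV_along_line[of f X 0 P] diff by simp
  then have "\<exists>d>0. \<forall>h>0. h < d \<longrightarrow> f (X + (0 + h) *\<^sub>R P) < f (X + 0 *\<^sub>R P)"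
    by (rule DERIV_neg_dec_right) (use neg in simp)
  then obtain d where d: "0 < d" "\<And>h. 0 < h \<Longrightarrow> h < d \<Longrightarrow> f (X + h *\<^sub>R P) < f X"
    by auto
  have "f X \<le> f (X + (d / 2) *\<^sub>R P)" using d(1) by (intro min psd_add X psd_scaleR P) auto
  then show False using d(2)[of "d / 2"] d(1) by simp
qed

section \<open>Spectral data of the truncation\<close>

lemma outer_mult_vector: "outer u w *v x = (w \<bullet> x) *\<^sub>R u"
  by (simp add: outer_def matrix_vector_mult_def vec_eq_iff inner_vec_def sum_distrib_left mult_ac)

lemma sum_outer_mult_vector:
  "(\<Sum>i\<in>I. c i *\<^sub>R outer (v i) (v i)) *v x = (\<Sum>i\<in>I. (c i * (v i \<bullet> x)) *\<^sub>R v i)"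
  by (induction I rule: infinite_finite_induct)
    (auto simp: matrix_vector_mult_add_rdistrib scaleR_matrix_vector_assoc[symmetric] outer_mult_vector)

lemma psd_sum_outer:
  assumes "\<And>i. i \<in> I \<Longrightarrow> 0 \<le> c i"
  shows "psd (\<Sum>i\<in>I. c i *\<^sub>R outer (v i) (v i))"
  using assms
proof (induction I rule: infinite_finite_induct)
  case (insert i I)
  have "psd (outer (v i) (v i))"
    by (simp add: psd_def outer_mult_vector inner_commute) (simp add: outer_def transpose_def vec_eq_iff)
  then show ?case using insert by (auto intro: psd_add psd_scaleR)
qed (simp_all add: psd_zero)

text \<open>The right singular vectors of \<^term>\<open>Usr\<close> are the normalised images of the leading
  eigenvectors of \<^term>\<open>Xs\<close> under the transpose of \<^term>\<open>Usr\<close>.\<close>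

lemma truncated_eig_spectrum:
  fixes Xs Xsr :: "real^'n^'n" and Usr :: "real^'r^'n"
  assumes psd: "psd Xs" and rank: "CARD('r) \<le> rank Xs"
    and trunc: "truncated_eig Xs CARD('r) Xsr" and Usr: "Xsr = Usr ** transpose Usr"
  obtains s L where "sigma Xs 1 = L" "sigma Xs CARD('r) = s" "sigma Usr CARD('r) = sqrt s"
    "0 < s" "s \<le> L" "L \<le> spec_norm Xs" "psd (Xs - Xsr)"
    "\<And>x. norm (Usr *v x) \<le> sqrt L * norm x" "\<And>x. s * (norm x)\<^sup>2 \<le> (norm (Usr *v x))\<^sup>2"
proof -
  let ?n = "CARD('n)" and ?r = "CARD('r)"
  obtain v :: "nat \<Rightarrow> real^'n" and lam where v: "orthonormal_family v"
    and mono: "\<And>i j. i \<le> j \<Longrightarrow> j < ?n \<Longrightarrow> lam j \<le> lam i"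
    and Xs: "Xs = (\<Sum>i<?n. lam i *\<^sub>R outer (v i) (v i))"
    and Xsr: "Xsr = (\<Sum>i<?r. lam i *\<^sub>R outer (v i) (v i))"
    using trunc unfolding truncated_eig_def orthonormal_family_def by blast
  have r_n: "?r \<le> ?n" using rank rank_bound[of Xs] by simp
  have r_pos: "1 \<le> ?r" by (simp add: Suc_leI)
  have eig: "(\<Sum>i<k. lam i *\<^sub>R outer (v i) (v i)) *v v j = lam j *\<^sub>R v j" if "j < k" "k \<le> ?n" for j k
  proof -
    have "(\<Sum>i<k. lam i *\<^sub>R outer (v i) (v i)) *v v j = (\<Sum>i<k. if i = j then lam j *\<^sub>R v j else 0)"
      unfolding sum_outer_mult_vector
      by (intro sum.cong) (use that in \<open>auto simp: orthonormal_familyD[OF v]\<close>)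
    then show ?thesis using that by simp
  qed
  have Xs_eig: "Xs *v v j = lam j *\<^sub>R v j" if "j < ?n" for j
    using eig[OF that] by (simp add: Xs)
  have Xsr_eig: "Xsr *v v j = lam j *\<^sub>R v j" if "j < ?r" for j
    using eig[OF that r_n] by (simp add: Xsr)
  have lam_nonneg: "0 \<le> lam j" if "j < ?n" for j
  proof -
    have "0 \<le> v j \<bullet> (Xs *v v j)" using psd by (simp add: psd_def)
    then show ?thesis using that by (simp add: Xs_eig orthonormal_familyD[OF v])
  qed
  \<comment> \<open>As \<open>Xs\<close> is symmetric, \<open>transpose Xs ** Xs\<close> has
    eigenvalues \<open>(lam i)\<^sup>2\<close>; nonnegativity of \<open>lam\<close> preserves their
    order under squaring and removes the square root.\<close>
  have sigma_Xs: "sigma Xs k = lam (k - 1)" if "1 \<le> k" "k \<le> ?n" for k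
  proof -
    have "sigma Xs k = sqrt ((lam (k - 1))\<^sup>2)"
    proof (rule sigma_eigenbasis[OF v])
      show "(transpose Xs ** Xs) *v v i = (lam i)\<^sup>2 *\<^sub>R v i" if "i < ?n" for i
        using psd that by (simp add: psd_def matrix_vector_mul_assoc[symmetric] Xs_eig
            matrix_vector_mult_scaleR power2_eq_square)
      show "(lam j)\<^sup>2 \<le> (lam i)\<^sup>2" if "i \<le> j" "j < ?n" for i j
        using that by (intro power_mono mono lam_nonneg)
    qed (use that in auto)
    then show ?thesis using that by (simp add: lam_nonneg)
  qed
  define s where "s = lam (?r - 1)"
  have s_le: "s \<le> lam i" if "i < ?r" for i
    unfolding s_def using that r_n by (intro mono) auto
  \<comment> \<open>The rank hypothesis enters here: otherwise all eigenvalues from index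
    \<open>?r - 1\<close> on vanish, and the range of \<open>Xs\<close> is spanned by
    \<open>?r - 1\<close> vectors.\<close>
  have s_pos: "0 < s"
  proof (rule ccontr)
    assume "\<not> 0 < s"
    then have zero: "lam i = 0" if "?r - 1 \<le> i" "i < ?n" for i
      using mono[OF that] lam_nonneg[OF that(2)] by (simp add: s_def)
    have "range (\<lambda>x. Xs *v x) \<subseteq> span (v ` {..<?r - 1})"
    proof (clarify)
      fix x
      show "Xs *v x \<in> span (v ` {..<?r - 1})"
        unfolding Xs sum_outer_mult_vector
      proof (rule span_sum)
        fix i assume i: "i \<in> {..<?n}"
        show "(lam i * (v i \<bullet> x)) *\<^sub>R v i \<in> span (v ` {..<?r - 1})"
        proof (cases "i < ?r - 1")
          case True
          then show ?thesis by (intro span_scale span_base) auto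
        next
          case False
          then have "lam i = 0" using i by (intro zero) auto
          then show ?thesis by (simp add: span_zero)
        qed
      qed
    qed
    then have "rank Xs \<le> card (v ` {..<?r - 1})"
      unfolding rank_dim_range by (intro dim_le_card) auto
    also have "\<dots> \<le> ?r - 1" using card_image_le[of "{..<?r - 1}" v] by simp
    finally show False using rank r_pos by linarith
  qed
  have lam_pos: "0 < lam i" if "i < ?r" for i using s_le[OF that] s_pos by simp
  \<comment> \<open>The images have squared length \<open>lam i\<close>, hence the scaling. There
    are exactly \<open>?r\<close> of them, so \<open>w\<close> is a full eigenbasis for
    \<open>transpose Usr ** Usr\<close>.\<close>
  define w where "w i = (1 / sqrt (lam i)) *\<^sub>R (transpose Usr *v v i)" for i
  have w: "orthonormal_family w"
    unfolding orthonormal_family_def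
  proof (intro allI impI)
    fix i j assume ij: "i < ?r" "j < ?r"
    have "(transpose Usr *v v i) \<bullet> (transpose Usr *v v j) = v i \<bullet> (Xsr *v v j)"
      unfolding Usr by (metis inner_commute inner_transpose_vector matrix_vector_mul_assoc)
    also have "\<dots> = (if i = j then lam j else 0)"
      using ij r_n by (simp add: Xsr_eig orthonormal_familyD[OF v])
    finally show "w i \<bullet> w j = (if i = j then 1 else 0)"
      using lam_pos[OF ij(1)] by (auto simp: w_def)
  qed
  have w_eig: "(transpose Usr ** Usr) *v w i = lam i *\<^sub>R w i" if "i < ?r" for i
  proof -
    have "(transpose Usr ** Usr) *v (transpose Usr *v v i) = transpose Usr *v (Xsr *v v i)"
      unfolding Usr by (simp add: matrix_vector_mul_assoc matrix_mul_assoc)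
    then show ?thesis
      using that by (simp add: w_def Xsr_eig matrix_vector_mult_scaleR scaleR_left_commute)
  qed
  have sigma_Usr: "sigma Usr ?r = sqrt s"
    unfolding s_def
    by (rule sigma_eigenbasis[OF w w_eig]) (use r_pos r_n in \<open>auto intro: mono\<close>)
  have quad: "(norm (Usr *v x))\<^sup>2 = (\<Sum>i<?r. lam i * (w i \<bullet> x)\<^sup>2)" for x
    unfolding norm_vector_sq by (rule eigenbasis_quadratic_form[OF w w_eig])
  define L where "L = lam 0"
  have L: "lam i \<le> L" if "i < ?n" for i
    unfolding L_def using that by (intro mono) auto
  have s_L: "s \<le> L" unfolding s_def using r_n r_pos by (intro L) linarith
  have upper: "norm (Usr *v x) \<le> sqrt L * norm x" for x
  proof (rule power2_le_imp_le)
    have "(norm (Usr *v x))\<^sup>2 \<le> (\<Sum>i<?r. L * (w i \<bullet> x)\<^sup>2)"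
      unfolding quad using r_n by (intro sum_mono mult_right_mono L) auto
    also have "\<dots> = (sqrt L * norm x)\<^sup>2"
      using s_L s_pos by (simp add: power_mult_distrib orthonormal_family_norm_sq[OF w] sum_distrib_left)
    finally show "(norm (Usr *v x))\<^sup>2 \<le> (sqrt L * norm x)\<^sup>2" .
  qed (use s_L s_pos in auto)
  have lower: "s * (norm x)\<^sup>2 \<le> (norm (Usr *v x))\<^sup>2" for x
    unfolding quad orthonormal_family_norm_sq[OF w] sum_distrib_left
    by (intro sum_mono mult_right_mono s_le) auto
  have L_spec: "L \<le> spec_norm Xs"
  proof -
    have n0: "0 < ?n" by simp
    have "v 0 \<bullet> v 0 = 1" using orthonormal_familyD[OF v n0 n0] by simp
    then have "norm (v 0) = 1" by (simp add: norm_eq_1)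
    then show ?thesis
      using inner_spec_norm_le[of "v 0" Xs] Xs_eig[OF n0] \<open>v 0 \<bullet> v 0 = 1\<close> by (simp add: L_def)
  qed
  have "Xs - Xsr = (\<Sum>i\<in>{?r..<?n}. lam i *\<^sub>R outer (v i) (v i))"
    unfolding Xs Xsr lessThan_atLeast0 using sum.atLeastLessThan_concat[of 0 ?r ?n] r_n
    by (metis (no_types, lifting) add_diff_cancel_left' le0)
  then have psd_diff: "psd (Xs - Xsr)" by (auto intro!: psd_sum_outer lam_nonneg)
  show thesis
    by (rule that[OF _ _ sigma_Usr s_pos s_L L_spec psd_diff upper lower])
      (use r_pos r_n in \<open>auto simp: sigma_Xs L_def s_def\<close>)
qed

section \<open>One gradient step\<close>

text \<open>\<open>U\<close> inherits the bound of its transpose: bound the squared norm of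
  \<open>U *v x\<close> by Cauchy-Schwarz with \<open>transpose U *v (U *v x)\<close>, then cancel
  one factor.\<close>

lemma norm_vector_le_spec_norm:
  fixes U :: "real^'k^'n"
  shows "norm (U *v x) \<le> sqrt (spec_norm (U ** transpose U)) * norm x"
proof (cases "U *v x = 0")
  case False
  have "norm (U *v x) * norm (U *v x) = x \<bullet> (transpose U *v (U *v x))"
    by (simp add: inner_transpose_vector flip: power2_norm_eq_inner power2_eq_square)
  also have "\<dots> \<le> norm x * norm (transpose U *v (U *v x))" by (rule norm_cauchy_schwarz)
  also have "\<dots> \<le> norm x * (sqrt (spec_norm (U ** transpose U)) * norm (U *v x))"
    by (intro mult_left_mono norm_transpose_vector_le norm_ge_zero)
  finally show ?thesis using False by (simp add: mult_ac)
qed (simp add: spec_norm_nonneg)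

section \<open>Perturbation bounds for outer squares\<close>

lemma outer_square_perturbation:
  "W ** transpose W - V ** transpose V =
    ((W - V) ** transpose V + V ** transpose (W - V)) + (W - V) ** transpose (W - V)"
  for V W :: "real^'k^'n"
  by (simp add: matrix_algebra)

lemma norm_outer_square_diff_le:
  fixes V W :: "real^'k^'n"
  assumes V: "\<And>x. norm (V *v x) \<le> c * norm x" and c: "0 \<le> c" and d: "norm (W - V) \<le> d"
  shows "norm (W ** transpose W - V ** transpose V) \<le> d * (2 * c + d)"
proof -
  define D where "D = W - V"
  have 1: "norm (D ** transpose V) \<le> c * norm D" by (rule norm_mult_transpose_le[OF V c])
  have 2: "norm (V ** transpose D) \<le> c * norm D"
    using norm_mult_le[OF V c, of "transpose D"] by (simp add: norm_transpose)
  have 3: "norm (D ** transpose D) \<le> norm D * norm D"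
    using norm_mult_submult[of D "transpose D"] by (simp add: norm_transpose)
  have "norm (W ** transpose W - V ** transpose V) \<le>
      norm (D ** transpose V) + norm (V ** transpose D) + norm (D ** transpose D)"
    unfolding outer_square_perturbation D_def by (intro norm_triangle_le add_mono) auto
  also have "\<dots> \<le> norm D * (2 * c + norm D)" using 1 2 3 by (simp add: algebra_simps)
  also have "\<dots> \<le> d * (2 * c + d)" using d c order_trans[OF norm_ge_zero d] by (intro mult_mono) (auto simp: D_def)
  finally show ?thesis .
qed

text \<open>In the square of the linear part \<open>A\<close>, the mixed term is the squared norm of
  \<open>Z\<close>, hence nonnegative, once \<open>Z\<close> is symmetric. So \<open>A\<close> has
  norm at least \<open>sqrt 2 * a\<close>, and the quadratic remainder costs at most
  \<open>a / 100\<close>.\<close>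

lemma norm_outer_square_diff_ge:
  fixes V W :: "real^'k^'n"
  assumes V: "\<And>x. s * (norm x)\<^sup>2 \<le> (norm (V *v x))\<^sup>2" and s: "0 \<le> s"
    and sym: "transpose (transpose V ** W) = transpose V ** W"
    and d: "norm (W - V) \<le> sqrt s / 100"
  shows "s * (norm (W - V))\<^sup>2 \<le> (norm (W ** transpose W - V ** transpose V))\<^sup>2"
proof -
  define D where "D = W - V"
  define Z where "Z = transpose V ** D"
  define A where "A = D ** transpose V + V ** transpose D"
  have "transpose Z = Z" using sym by (simp add: Z_def D_def matrix_algebra)
  then have Z: "transpose D ** V = Z" by (simp add: Z_def matrix_transpose_mul)
  have cross: "(V ** transpose D) \<bullet> (D ** transpose V) = Z \<bullet> Z"
  proof -
    have "(V ** transpose D) \<bullet> (D ** transpose V) = transpose D \<bullet> (transpose V ** (D ** transpose V))"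
      by (rule inner_mult_left)
    also have "\<dots> = (Z ** transpose V) \<bullet> transpose D"
      by (simp add: Z_def matrix_mul_assoc inner_commute)
    also have "\<dots> = Z \<bullet> Z" by (simp add: inner_mult_right Z)
    finally show ?thesis .
  qed
  have "norm (V ** transpose D) = norm (D ** transpose V)"
    by (metis matrix_transpose_mul norm_transpose transpose_transpose)
  then have "(norm A)\<^sup>2 = 2 * (norm (D ** transpose V))\<^sup>2 + 2 * (Z \<bullet> Z)"
    unfolding A_def power2_norm_eq_inner norm_eq
    by (simp add: inner_add_left inner_add_right cross inner_commute[of "D ** transpose V" "V ** transpose D"])
  then have A2: "2 * (s * (norm D)\<^sup>2) \<le> (norm A)\<^sup>2"
    using norm_mult_transpose_ge[OF V, of D] inner_ge_zero[of Z] by linarith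
  define a where "a = sqrt s * norm D"
  have a: "0 \<le> a" "a\<^sup>2 = s * (norm D)\<^sup>2" using s by (auto simp: a_def power_mult_distrib)
  \<comment> \<open>14/10 is a rational lower bound for the square root of 2.\<close>
  have A_ge: "14 / 10 * a \<le> norm A"
  proof (rule power2_le_imp_le)
    have "(14 / 10 * a)\<^sup>2 \<le> 2 * a\<^sup>2" by (simp add: power2_eq_square)
    then show "(14 / 10 * a)\<^sup>2 \<le> (norm A)\<^sup>2" using A2 a(2) by linarith
  qed simp
  have "norm (D ** transpose D) \<le> norm D * norm D"
    using norm_mult_submult[of D "transpose D"] by (simp add: norm_transpose)
  also have "\<dots> \<le> sqrt s / 100 * norm D" using d by (intro mult_right_mono) (auto simp: D_def)
  finally have DD: "norm (D ** transpose D) \<le> a / 100" by (simp add: a_def)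
  have "norm A - norm (D ** transpose D) \<le> norm (A + D ** transpose D)" by (rule norm_diff_ineq)
  then have "a \<le> norm (A + D ** transpose D)" using A_ge DD a by linarith
  then have "a\<^sup>2 \<le> (norm (A + D ** transpose D))\<^sup>2" using a by (intro power_mono)
  then show ?thesis using a by (simp add: outer_square_perturbation A_def D_def)
qed

text \<open>The descent lemma is applied between the two outer squares. The linear term gives about
  \<open>- 2 * \<eta> * g\<^sup>2\<close>, and the errors stay below
  \<open>\<eta> * g\<^sup>2\<close>. The bound 7/100 exceeds 1/16 because the step size is computed
  at another point.\<close>

lemma sufficient_decrease:
  fixes f :: "real^'n^'n \<Rightarrow> real" and U :: "real^'r^'n"
  assumes diff: "\<And>X. f differentiable (at X)" and symm: "\<And>X. f X = f (transpose X)"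
    and smooth: "M_smooth f M" and M: "0 < M" and eta: "0 < \<eta>"
    and G: "G = grad f (U ** transpose U)"
    and step1: "\<eta> * (M * spec_norm (U ** transpose U)) \<le> 7 / 100"
    and step2: "\<eta> * spec_norm G \<le> 7 / 100"
    and Up: "Up = U - \<eta> *\<^sub>R (G ** U)"
  shows "f (Up ** transpose Up) \<le> f (U ** transpose U) - \<eta> * (norm (G ** U))\<^sup>2"
proof -
  define X where "X = U ** transpose U"
  define N where "N = G ** U"
  define P where "P = Up ** transpose Up - X"
  define u where "u = sqrt (spec_norm X)"
  define g where "g = norm N"
  have u: "0 \<le> u" "u\<^sup>2 = spec_norm X" by (auto simp: u_def spec_norm_nonneg)
  have "transpose X = X" using psd_outer_square[of U] by (simp add: X_def psd_def)
  then have G_sym: "transpose G = G" using grad_symmetric[OF diff symm] by (simp add: G X_def)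
  have P: "P = \<eta>\<^sup>2 *\<^sub>R (N ** transpose N) - \<eta> *\<^sub>R (N ** transpose U + U ** transpose N)"
    by (simp add: P_def Up X_def N_def[symmetric] matrix_algebra algebra_simps power2_eq_square)
  have U_le: "norm (U *v x) \<le> u * norm x" for x
    using norm_vector_le_spec_norm[of U x] by (simp add: u_def X_def)
  have 1: "norm (N ** transpose U) \<le> u * g"
    unfolding g_def by (rule norm_mult_transpose_le[OF U_le u(1)])
  have 2: "norm (U ** transpose N) \<le> u * g"
    using norm_mult_le[OF U_le u(1), of "transpose N"] by (simp add: norm_transpose g_def)
  \<comment> \<open>One factor keeps its Frobenius norm; the other is split as \<open>G ** U\<close>
    and bounded on vectors.\<close>
  have 3: "norm (N ** transpose N) \<le> spec_norm G * u * g"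
    unfolding g_def
  proof (rule norm_mult_transpose_le)
    fix x
    have "norm (N *v x) \<le> spec_norm G * norm (U *v x)"
      unfolding N_def matrix_vector_mul_assoc[symmetric] by (rule spec_norm_vector_le)
    also have "\<dots> \<le> spec_norm G * (u * norm x)" by (intro mult_left_mono U_le spec_norm_nonneg)
    finally show "norm (N *v x) \<le> spec_norm G * u * norm x" by simp
  qed (simp add: u spec_norm_nonneg)
  have P_le: "norm P \<le> \<eta> * (u * g) * (2 + \<eta> * spec_norm G)"
  proof -
    have "norm P \<le> \<eta>\<^sup>2 * norm (N ** transpose N) + \<eta> * (norm (N ** transpose U) + norm (U ** transpose N))"
    proof -
      have "norm P \<le> norm (\<eta>\<^sup>2 *\<^sub>R (N ** transpose N)) + norm (\<eta> *\<^sub>R (N ** transpose U + U ** transpose N))"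
        unfolding P by (rule norm_triangle_ineq4)
      also have "norm (\<eta> *\<^sub>R (N ** transpose U + U ** transpose N)) \<le>
          \<eta> * (norm (N ** transpose U) + norm (U ** transpose N))"
        using eta by (simp add: norm_triangle_ineq)
      finally show ?thesis by simp
    qed
    also have "\<dots> \<le> \<eta>\<^sup>2 * (spec_norm G * u * g) + \<eta> * (u * g + u * g)"
      using eta by (intro add_mono mult_left_mono 1 2 3) auto
    finally show ?thesis by (simp add: algebra_simps power2_eq_square)
  qed
  have GNU: "G \<bullet> (N ** transpose U) = g\<^sup>2"
    using inner_mult_right[of G U N] by (simp add: N_def[symmetric] g_def dot_square_norm)
  have GUN: "G \<bullet> (U ** transpose N) = g\<^sup>2"
    using inner_transpose[of G "U ** transpose N"] GNU G_sym by (simp add: matrix_transpose_mul)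
  have GNN: "G \<bullet> (N ** transpose N) \<le> spec_norm G * g\<^sup>2"
  proof -
    have "G \<bullet> (N ** transpose N) = (G ** N) \<bullet> N" by (simp add: inner_mult_right)
    also have "\<dots> \<le> norm (G ** N) * norm N" by (rule norm_cauchy_schwarz)
    also have "\<dots> \<le> (spec_norm G * norm N) * norm N"
      by (intro mult_right_mono norm_mult_le spec_norm_vector_le spec_norm_nonneg norm_ge_zero)
    finally show ?thesis by (simp add: g_def power2_eq_square)
  qed
  have GP: "G \<bullet> P \<le> \<eta> * g\<^sup>2 * (\<eta> * spec_norm G - 2)"
  proof -
    have "G \<bullet> P = \<eta>\<^sup>2 * (G \<bullet> (N ** transpose N)) - \<eta> * (g\<^sup>2 + g\<^sup>2)"
      by (simp add: P inner_diff_right inner_add_right GNU GUN)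
    also have "\<dots> \<le> \<eta>\<^sup>2 * (spec_norm G * g\<^sup>2) - \<eta> * (g\<^sup>2 + g\<^sup>2)"
      by (intro diff_right_mono mult_left_mono GNN) auto
    finally show ?thesis by (simp add: algebra_simps power2_eq_square)
  qed
  \<comment> \<open>Numerically, 0.07 times half of 2.07 squared is just below 0.15.\<close>
  have P2: "M / 2 * (norm P)\<^sup>2 \<le> \<eta> * g\<^sup>2 * (15 / 100)"
  proof -
    have "norm P \<le> \<eta> * (u * g) * (2 + 7 / 100)"
      using eta u step2 by (intro order_trans[OF P_le] mult_left_mono) (auto simp: g_def)
    then have "(norm P)\<^sup>2 \<le> (\<eta> * (u * g) * (2 + 7 / 100))\<^sup>2" by (intro power_mono) auto
    then have "M / 2 * (norm P)\<^sup>2 \<le> M / 2 * (\<eta> * (u * g) * (2 + 7 / 100))\<^sup>2"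
      using M by (intro mult_left_mono) auto
    also have "\<dots> = (\<eta> * (M * spec_norm X)) * (\<eta> * g\<^sup>2) * ((2 + 7 / 100)\<^sup>2 / 2)"
      unfolding u(2)[symmetric] by (simp add: power2_eq_square)
    also have "\<dots> \<le> 7 / 100 * (\<eta> * g\<^sup>2) * ((2 + 7 / 100)\<^sup>2 / 2)"
      using step1 eta by (intro mult_right_mono) (auto simp: X_def)
    also have "\<dots> \<le> \<eta> * g\<^sup>2 * (15 / 100)" using eta by (simp add: power2_eq_square)
    finally show ?thesis .
  qed
  have "f (Up ** transpose Up) \<le> f X + G \<bullet> P + M / 2 * (norm P)\<^sup>2"
    unfolding P_def X_def G by (intro descent_lemma diff smooth psd_outer_square)
  also have "\<dots> \<le> f X + \<eta> * g\<^sup>2 * (7 / 100 - 2) + \<eta> * g\<^sup>2 * (15 / 100)"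
  proof -
    have "\<eta> * g\<^sup>2 * (\<eta> * spec_norm G - 2) \<le> \<eta> * g\<^sup>2 * (7 / 100 - 2)"
      using eta step2 by (intro mult_left_mono) auto
    then show ?thesis using GP P2 by linarith
  qed
  also have "\<dots> \<le> f X - \<eta> * g\<^sup>2"
  proof -
    have "0 \<le> \<eta> * g\<^sup>2" using eta by simp
    then show ?thesis by (simp add: algebra_simps)
  qed
  finally show ?thesis by (simp add: X_def N_def g_def)
qed

section \<open>Contraction of the squared distance and invariance of the neighbourhood\<close>

theorem theorem4p2:
  fixes f :: "real^'n^'n \<Rightarrow> real"
    and M m :: real
    and Xs Xsr :: "real^'n^'n"
    and Usr U0 U :: "real^'r^'n"
  assumes conv: "convex_on UNIV f"
    and diff: "\<forall>X. f differentiable (at X)"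
    and symm: "\<forall>X. f X = f (transpose X)"
    and Mpos: "0 < M" and mpos: "0 < m"
    and smooth: "M_smooth f M"
    and rsc: "restricted_strongly_convex f m CARD('r)"
    and Xs_psd: "psd Xs"
    and Xs_min: "\<forall>Y. psd Y \<longrightarrow> f Xs \<le> f Y"
    and rank_Xs: "CARD('r) \<le> rank Xs"
    and Xsr: "truncated_eig Xs CARD('r) Xsr"
    and Usr: "Xsr = Usr ** transpose Usr"
    and A2: "Dist U0 Usr \<le> (1 / (100 * (M / m)) * (sigma Xs CARD('r) / sigma Xs 1)) * sigma Usr CARD('r)"
    and A3: "norm (Xs - Xsr) \<le> 1 / (200 * (M / m) powr 1.5) * (sigma Xs CARD('r) / sigma Xs 1) * sigma Xs CARD('r)"
    and U: "Dist U Usr \<le> (1 / (100 * (M / m)) * (sigma Xs CARD('r) / sigma Xs 1)) * sigma Usr CARD('r)"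
  shows "let \<kappa> = M / m;
             \<rho>' = 1 / (100 * \<kappa>) * (sigma Xs CARD('r) / sigma Xs 1);
             X0 = U0 ** transpose U0;
             \<eta> = 1 / (16 * (M * spec_norm X0 + spec_norm (grad f X0)));
             X = U ** transpose U;
             Uplus = U - \<eta> *\<^sub>R (grad f X ** U);
             \<alpha> = 1 - m * sigma Xs CARD('r) / (64 * (M * spec_norm Xs + spec_norm (grad f Xs)));
             \<beta> = M / (28 * (M * spec_norm Xs + spec_norm (grad f Xs)))
         in (Dist Uplus Usr)\<^sup>2 \<le> \<alpha> * (Dist U Usr)\<^sup>2 + \<beta> * (norm (Xs - Xsr))\<^sup>2
            \<and> Dist Uplus Usr \<le> \<rho>' * sigma Usr CARD('r)"
proof -
  obtain s L where sigma: "sigma Xs 1 = L" "sigma Xs CARD('r) = s" "sigma Usr CARD('r) = sqrt s"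
    and s: "0 < s" "s \<le> L" and L_spec: "L \<le> spec_norm Xs" and psd_diff: "psd (Xs - Xsr)"
    and upper: "\<And>x. norm (Usr *v x) \<le> sqrt L * norm x"
    and lower: "\<And>x. s * (norm x)\<^sup>2 \<le> (norm (Usr *v x))\<^sup>2"
    using truncated_eig_spectrum[OF Xs_psd rank_Xs Xsr Usr] by metis
  have diff': "\<And>X. f differentiable (at X)" using diff by blast
  have symm': "\<And>X. f X = f (transpose X)" using symm by blast
  have Xsr_psd: "psd Xsr" unfolding Usr by (rule psd_outer_square)
  have rank_Xsr: "rank Xsr \<le> CARD('r)" unfolding Usr by (rule rank_outer_square_le)
  \<comment> \<open>\<open>\<tau>\<close> is the inverse condition number, so the assumed bounds
    become polynomial in \<open>\<tau>\<close>.\<close>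
  define \<tau> where "\<tau> = m / M"
  have m: "m = \<tau> * M" using Mpos by (simp add: \<tau>_def)
  have \<tau>0: "0 < \<tau>" using Mpos mpos by (simp add: \<tau>_def)
  \<comment> \<open>Strong convexity and smoothness bound \<open>f Xsr\<close> from below and above
    by the same linear model at 0. The quadratic terms can be compared because \<open>Xsr\<close> is
    nonzero, \<open>Usr\<close> being injective.\<close>
  have "m \<le> M"
  proof -
    have "Xsr \<noteq> 0"
    proof
      assume "Xsr = 0"
      obtain x :: "real^'r" where x: "norm x = 1" using vector_choose_size zero_le_one by blast
      have "(norm (transpose Usr *v (Usr *v x)))\<^sup>2 = 0"
        using \<open>Xsr = 0\<close> by (simp add: norm_transpose_vector_sq Usr[symmetric])
      then have "transpose Usr *v (Usr *v x) = 0" by simp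
      then have "(norm (Usr *v x))\<^sup>2 = 0"
        by (simp add: norm_vector_sq matrix_vector_mul_assoc[symmetric])
      then show False using lower[of x] x s by simp
    qed
    then have pos: "0 < (norm Xsr)\<^sup>2" by simp
    have "f Xsr \<ge> f 0 + grad f 0 \<bullet> (Xsr - 0) + m / 2 * (norm (Xsr - 0))\<^sup>2"
      using rsc psd_zero Xsr_psd rank_Xsr unfolding restricted_strongly_convex_def
      by (metis rank_0 zero_le)
    moreover have "f Xsr \<le> f 0 + grad f 0 \<bullet> (Xsr - 0) + M / 2 * (norm (Xsr - 0))\<^sup>2"
      by (rule descent_lemma[OF diff' smooth psd_zero Xsr_psd])
    ultimately have "m / 2 * (norm Xsr)\<^sup>2 \<le> M / 2 * (norm Xsr)\<^sup>2" by simp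
    then show ?thesis using pos by simp
  qed
  then have \<tau>1: "\<tau> \<le> 1" using Mpos by (simp add: \<tau>_def)
  define \<rho> where "\<rho> = 1 / (100 * (M / m)) * (s / L) * sqrt s"
  have \<rho>: "\<rho> = \<tau> / 100 * (s / L) * sqrt s"
    using Mpos mpos by (simp add: \<rho>_def \<tau>_def field_simps)
  have sL: "0 < s / L" "s / L \<le> 1" "0 < L" using s by auto
  have sqrtL: "0 < sqrt s" "sqrt s \<le> sqrt L" using s by auto
  have \<rho>_pos: "0 < \<rho>" using \<tau>0 sL sqrtL by (simp add: \<rho>)
  have \<rho>_s: "\<rho> \<le> sqrt s / 100"
  proof -
    have "\<tau> * (s / L) \<le> 1" using \<tau>0 \<tau>1 sL by (intro mult_le_one) auto
    then have "\<tau> * (s / L) * sqrt s \<le> 1 * sqrt s" using sqrtL by (intro mult_right_mono) auto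
    then show ?thesis by (simp add: \<rho>)
  qed
  \<comment> \<open>The bracket is at most \<open>2.01 * sqrt L\<close>, and
    \<open>sqrt s * sqrt L\<close> \<le> \<open>L\<close> cancels the denominator in
    \<open>s / L\<close>.\<close>
  have near_bound: "\<rho> * (2 * sqrt L + \<rho>) \<le> 201 / 10000 * (\<tau> * s)"
  proof -
    have "\<rho> * (2 * sqrt L + \<rho>) \<le> \<rho> * (2 * sqrt L + sqrt L / 100)"
      using \<rho>_pos \<rho>_s sqrtL by (intro mult_left_mono) linarith+
    also have "\<dots> = 201 / 10000 * (\<tau> * ((s / L) * (sqrt s * sqrt L)))" by (simp add: \<rho> field_simps)
    also have "\<dots> \<le> 201 / 10000 * (\<tau> * ((s / L) * (sqrt L * sqrt L)))"
      using \<tau>0 sL sqrtL by (intro mult_left_mono mult_right_mono) auto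
    also have "\<dots> = 201 / 10000 * (\<tau> * s)" using sL by simp
    finally show ?thesis .
  qed
  define e where "e = norm (Xs - Xsr)"
  have e0: "0 \<le> e" by (simp add: e_def)
  \<comment> \<open>The squared form keeps the full power of \<open>\<tau>\<close> for the
    invariance claim; the linear form, weakened by \<open>M / m\<close> \<le> \<open>k\<close>,
    serves for closeness to \<open>Xs\<close>.\<close>
  have e_sq: "e\<^sup>2 \<le> \<tau> ^ 3 / 40000 * (s / L)\<^sup>2 * s\<^sup>2" and e_le: "e \<le> \<tau> * s / 200"
  proof -
    define k where "k = (M / m) powr 1.5"
    have e: "e \<le> 1 / (200 * k) * (s / L) * s" using A3 unfolding sigma by (simp add: e_def k_def)
    have "k\<^sup>2 = (M / m) powr (1.5 + 1.5)" unfolding k_def power2_eq_square by (rule powr_add[symmetric])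
    also have "\<dots> = (M / m) ^ 3" using powr_realpow[of "M / m" 3] Mpos mpos by simp
    finally have k2: "k\<^sup>2 = (M / m) ^ 3" .
    have "1 / k\<^sup>2 = \<tau> ^ 3" unfolding k2 by (simp add: \<tau>_def power_divide)
    moreover have "e\<^sup>2 \<le> (1 / (200 * k) * (s / L) * s)\<^sup>2" using e e0 by (intro power_mono)
    moreover have "(1 / (200 * k) * (s / L) * s)\<^sup>2 = (1 / k\<^sup>2) / 40000 * (s / L)\<^sup>2 * s\<^sup>2"
      by (simp add: power_mult_distrib power_divide)
    ultimately show "e\<^sup>2 \<le> \<tau> ^ 3 / 40000 * (s / L)\<^sup>2 * s\<^sup>2" by metis
    have "(M / m) powr 1 \<le> k" unfolding k_def using \<open>m \<le> M\<close> mpos by (intro powr_mono) auto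
    then have "M / m \<le> k" using Mpos mpos by simp
    then have "1 / k \<le> 1 / (M / m)" using Mpos mpos by (intro divide_left_mono mult_pos_pos) (auto intro: order_less_le_trans[of 0 "M/m"])
    then have "1 / k \<le> \<tau>" by (simp add: \<tau>_def)
    have "e \<le> (1 / k) * ((s / L) * s) / 200" using e by simp
    also have "\<dots> \<le> \<tau> * ((s / L) * s) / 200"
      using \<open>1 / k \<le> \<tau>\<close> sL s by (intro divide_right_mono mult_right_mono) auto
    also have "\<dots> \<le> \<tau> * (1 * s) / 200"
      using \<tau>0 sL s by (intro divide_right_mono mult_left_mono mult_right_mono) auto
    finally show "e \<le> \<tau> * s / 200" by simp
  qed
  have rotate: "norm ((Usr ** R) *v x) \<le> sqrt L * norm x" "s * (norm x)\<^sup>2 \<le> (norm ((Usr ** R) *v x))\<^sup>2"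
    if "orthogonal_matrix R" for R x
  proof -
    have "(norm (R *v x))\<^sup>2 = (norm x)\<^sup>2"
      using that by (simp add: norm_vector_sq orthogonal_matrix dot_square_norm)
    then have R: "norm (R *v x) = norm x" by simp
    show "norm ((Usr ** R) *v x) \<le> sqrt L * norm x" "s * (norm x)\<^sup>2 \<le> (norm ((Usr ** R) *v x))\<^sup>2"
      using upper[of "R *v x"] lower[of "R *v x"] by (simp_all add: R matrix_vector_mul_assoc)
  qed
  \<comment> \<open>201/10000 from the distance to \<open>Xsr\<close>, plus 50/10000 from the
    truncation error.\<close>
  have near: "norm (W ** transpose W - Xs) \<le> 251 / 10000 * (\<tau> * s)" if "Dist W Usr \<le> \<rho>" for W
  proof -
    obtain R where R: "orthogonal_matrix R" "Dist W Usr = norm (W - Usr ** R)" by (rule Dist_attained)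
    have "norm (W ** transpose W - (Usr ** R) ** transpose (Usr ** R)) \<le> \<rho> * (2 * sqrt L + \<rho>)"
      by (rule norm_outer_square_diff_le) (use rotate(1) R that sL in auto)
    then have "norm (W ** transpose W - Xsr) \<le> 201 / 10000 * (\<tau> * s)"
      using near_bound orthogonal_matrix_mult_transpose[OF R(1), of Usr] by (simp add: Usr)
    then show ?thesis
      using norm_triangle_ineq[of "W ** transpose W - Xsr" "Xsr - Xs"] e_le
      by (simp add: e_def norm_minus_commute[of Xsr])
  qed
  define D where "D X = M * spec_norm X + spec_norm (grad f X)" for X
  have grad_near: "norm (grad f X - grad f Xs) \<le> 251 / 10000 * (m * s)"
    if "psd X" "norm (X - Xs) \<le> 251 / 10000 * (\<tau> * s)" for X
  proof -
    have "norm (grad f X - grad f Xs) \<le> M * norm (X - Xs)"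
      using smooth that(1) Xs_psd by (auto simp: M_smooth_def)
    also have "\<dots> \<le> M * (251 / 10000 * (\<tau> * s))" using that Mpos by (intro mult_left_mono) auto
    finally show ?thesis by (simp add: m mult_ac)
  qed
  have Ds: "M * s \<le> D Xs"
    unfolding D_def using s L_spec Mpos spec_norm_nonneg[of "grad f Xs"]
    by (intro add_increasing2 mult_left_mono) auto
  have Ds_pos: "0 < D Xs" using Ds Mpos s by (smt (verit) mult_pos_pos)
  \<comment> \<open>Both summands of \<open>D\<close> change by at most
    \<open>251 / 10000 * (m * s)\<close>, and \<open>m * s\<close> \<le>
    \<open>D Xs\<close>.\<close>
  have D_near: "D X \<le> 10502 / 10000 * D Xs" "9498 / 10000 * D Xs \<le> D X"
    if "psd X" "norm (X - Xs) \<le> 251 / 10000 * (\<tau> * s)" for X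
  proof -
    have ms: "m * s \<le> D Xs" using Ds mult_right_mono[OF \<open>m \<le> M\<close> less_imp_le[OF s(1)]] by linarith
    have "M * norm (X - Xs) \<le> M * (251 / 10000 * (\<tau> * s))"
      using that Mpos by (intro mult_left_mono) auto
    then have 1: "M * norm (X - Xs) \<le> 251 / 10000 * (m * s)" by (simp add: m mult_ac)
    have 2: "M * spec_norm X \<le> M * spec_norm Xs + M * norm (X - Xs)"
            "M * spec_norm Xs \<le> M * spec_norm X + M * norm (X - Xs)"
      using mult_left_mono[OF spec_norm_le_add[of X Xs], of M] mult_left_mono[OF spec_norm_le_add[of Xs X], of M]
        Mpos by (simp_all add: distrib_left norm_minus_commute)
    note 3 = spec_norm_le_add[of "grad f X" "grad f Xs"] spec_norm_le_add[of "grad f Xs" "grad f X"]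
      grad_near[OF that] norm_minus_commute[of "grad f X" "grad f Xs"]
    have "D X \<le> D Xs + 502 / 10000 * (m * s)" "D Xs \<le> D X + 502 / 10000 * (m * s)"
      using 1 2 3 by (simp_all add: D_def)
    then show "D X \<le> 10502 / 10000 * D Xs" "9498 / 10000 * D Xs \<le> D X" using ms by simp_all
  qed
  define X0 where "X0 = U0 ** transpose U0"
  define X where "X = U ** transpose U"
  define G where "G = grad f X"
  define \<eta> where "\<eta> = 1 / (16 * D X0)"
  define Up where "Up = U - \<eta> *\<^sub>R (G ** U)"
  have U0_near: "norm (X0 - Xs) \<le> 251 / 10000 * (\<tau> * s)"
    unfolding X0_def by (rule near) (use A2[unfolded sigma] in \<open>simp add: \<rho>_def\<close>)
  have U_\<rho>: "Dist U Usr \<le> \<rho>" using U unfolding sigma by (simp add: \<rho>_def)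
  have U_near: "norm (X - Xs) \<le> 251 / 10000 * (\<tau> * s)"
    unfolding X_def by (rule near[OF U_\<rho>])
  have X0_psd: "psd X0" and X_psd: "psd X" by (simp_all add: X0_def X_def psd_outer_square)
  note D0 = D_near[OF X0_psd U0_near] and DX = D_near[OF X_psd U_near]
  have D0_pos: "0 < D X0" using D0 Ds_pos by linarith
  have \<eta>_pos: "0 < \<eta>" using D0_pos by (simp add: \<eta>_def)
  \<comment> \<open>The ratio 10502/9498 divided by 16 is below 7/100.\<close>
  have \<eta>D: "\<eta> * D X \<le> 7 / 100" using DX D0 Ds_pos D0_pos by (simp add: \<eta>_def divide_le_eq)
  obtain R where R: "orthogonal_matrix R" "Dist U Usr = norm (U - Usr ** R)"
    and sym: "transpose (transpose (Usr ** R) ** U) = transpose (Usr ** R) ** U"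
    by (rule Dist_attained_symmetric)
  define V where "V = Usr ** R"
  define \<Delta> where "\<Delta> = U - V"
  define N where "N = G ** U"
  have VV: "V ** transpose V = Xsr" by (simp add: V_def Usr orthogonal_matrix_mult_transpose[OF R(1)])
  have dist: "Dist U Usr = norm \<Delta>" by (simp add: \<Delta>_def V_def R(2))
  have decrease: "f (Up ** transpose Up) \<le> f X - \<eta> * (norm N)\<^sup>2"
    unfolding X_def N_def
  proof (rule sufficient_decrease[OF diff' symm' smooth Mpos \<eta>_pos])
    have "\<eta> * (M * spec_norm X) \<le> \<eta> * D X" "\<eta> * spec_norm G \<le> \<eta> * D X"
      using \<eta>_pos Mpos by (auto simp: D_def G_def spec_norm_nonneg intro!: mult_left_mono)
    then show "\<eta> * (M * spec_norm (U ** transpose U)) \<le> 7 / 100" "\<eta> * spec_norm G \<le> 7 / 100"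
      using \<eta>D by (simp_all add: X_def)
  qed (simp_all add: G_def X_def Up_def)
  have opt: "0 \<le> grad f Xs \<bullet> P" if "psd P" for P
    using grad_psd_minimizer_nonneg[OF diff' Xs_psd _ that] Xs_min by blast
  have "f Xsr \<le> f Xs + grad f Xs \<bullet> (Xsr - Xs) + M / 2 * (norm (Xsr - Xs))\<^sup>2"
    by (rule descent_lemma[OF diff' smooth Xs_psd Xsr_psd])
  \<comment> \<open>\<open>Xs - Xsr\<close> is PSD, so optimality gives the linear term the right
    sign and only the quadratic error remains.\<close>
  moreover have "grad f Xs \<bullet> (Xsr - Xs) \<le> 0" using opt[OF psd_diff] by (simp add: inner_diff_right)
  ultimately have f_Xsr: "f Xsr \<le> f Xs + M / 2 * e\<^sup>2" by (simp add: e_def norm_minus_commute)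
  have f_Up: "f Xs \<le> f (Up ** transpose Up)" using Xs_min psd_outer_square by blast
  have rank_X: "rank X \<le> CARD('r)" unfolding X_def by (rule rank_outer_square_le)
  have "f Xsr \<ge> f X + G \<bullet> (Xsr - X) + m / 2 * (norm (Xsr - X))\<^sup>2"
    unfolding G_def using rsc X_psd Xsr_psd rank_X rank_Xsr by (auto simp: restricted_strongly_convex_def)
  then have convex: "G \<bullet> (X - Xsr) \<ge> f X - f Xsr + m / 2 * (norm (X - Xsr))\<^sup>2"
    by (simp add: inner_diff_right norm_minus_commute)
  have X_lower: "s * (norm \<Delta>)\<^sup>2 \<le> (norm (X - Xsr))\<^sup>2"
    using norm_outer_square_diff_ge[of s V U] rotate(2)[OF R(1)] s sym U_\<rho> \<rho>_s dist
    by (simp add: \<Delta>_def V_def[symmetric] VV X_def)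
  have curvature: "- (G \<bullet> (\<Delta> ** transpose \<Delta>)) \<le> 251 / 10000 * (m * s) * (norm \<Delta>)\<^sup>2"
  proof -
    have "- (G \<bullet> (\<Delta> ** transpose \<Delta>)) \<le> (grad f Xs - G) \<bullet> (\<Delta> ** transpose \<Delta>)"
      using opt[OF psd_outer_square[of \<Delta>]] by (simp add: inner_diff_left)
    also have "\<dots> \<le> norm (grad f Xs - G) * norm (\<Delta> ** transpose \<Delta>)" by (rule norm_cauchy_schwarz)
    also have "\<dots> \<le> 251 / 10000 * (m * s) * (norm \<Delta>)\<^sup>2"
    proof (rule mult_mono)
      show "norm (grad f Xs - G) \<le> 251 / 10000 * (m * s)"
        using grad_near[OF X_psd U_near] by (simp add: G_def norm_minus_commute)
      show "norm (\<Delta> ** transpose \<Delta>) \<le> (norm \<Delta>)\<^sup>2"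
        using norm_mult_submult[of \<Delta> "transpose \<Delta>"] by (simp add: norm_transpose power2_eq_square)
    qed (use mpos s in auto)
    finally show ?thesis .
  qed
  have "transpose X = X" using X_psd by (simp add: psd_def)
  then have G_sym: "transpose G = G" unfolding G_def by (rule grad_symmetric[OF diff' symm'])
  have cross: "2 * (N \<bullet> \<Delta>) = G \<bullet> (X - Xsr) + G \<bullet> (\<Delta> ** transpose \<Delta>)"
  proof -
    have 1: "N \<bullet> \<Delta> = G \<bullet> (\<Delta> ** transpose U)" unfolding N_def by (rule inner_mult_right)
    have 2: "G \<bullet> (U ** transpose \<Delta>) = G \<bullet> (\<Delta> ** transpose U)"
      using inner_transpose[of G "U ** transpose \<Delta>"] G_sym by (simp add: matrix_transpose_mul)
    \<comment> \<open>Substituting \<open>V = U - \<Delta>\<close> symmetrizes the product; both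
      halves pair equally with the symmetric \<open>G\<close>.\<close>
    have "X - Xsr + \<Delta> ** transpose \<Delta> = \<Delta> ** transpose U + U ** transpose \<Delta>"
      unfolding VV[symmetric] X_def \<Delta>_def by (simp add: matrix_algebra)
    then have "G \<bullet> (X - Xsr) + G \<bullet> (\<Delta> ** transpose \<Delta>) = G \<bullet> (\<Delta> ** transpose U) + G \<bullet> (U ** transpose \<Delta>)"
      by (metis inner_add_right)
    then show ?thesis using 1 2 by simp
  qed
  \<comment> \<open>\<open>convex\<close> needs a lower bound on \<open>f X - f Xsr\<close>:
    \<open>decrease\<close> and \<open>f_Up\<close> give \<open>f X\<close> \<ge>
    \<open>f Xs + \<eta> * (norm N)\<^sup>2\<close>, and \<open>f_Xsr\<close> handles the
    rest.\<close>
  have descent: "2 * (N \<bullet> \<Delta>) \<ge> \<eta> * (norm N)\<^sup>2 + (1 / 2 - 251 / 10000) * (m * s) * (norm \<Delta>)\<^sup>2 - M / 2 * e\<^sup>2"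
  proof -
    have "m / 2 * (s * (norm \<Delta>)\<^sup>2) \<le> m / 2 * (norm (X - Xsr))\<^sup>2"
      using mpos X_lower by (intro mult_left_mono) auto
    then show ?thesis
      using cross convex curvature decrease f_Up f_Xsr by (simp add: algebra_simps)
  qed
  have "Dist Up Usr \<le> norm (Up - V)" unfolding V_def by (rule Dist_le[OF R(1)])
  then have "(Dist Up Usr)\<^sup>2 \<le> (norm (Up - V))\<^sup>2"
  proof (rule power_mono)
    obtain Q where "orthogonal_matrix Q" "Dist Up Usr = norm (Up - Usr ** Q)" by (rule Dist_attained)
    then show "0 \<le> Dist Up Usr" by simp
  qed
  also have "Up - V = \<Delta> - \<eta> *\<^sub>R N" by (simp add: Up_def \<Delta>_def N_def)
  also have "(norm (\<Delta> - \<eta> *\<^sub>R N))\<^sup>2 = (norm \<Delta>)\<^sup>2 - \<eta> * (2 * (N \<bullet> \<Delta>)) + \<eta> * (\<eta> * (norm N)\<^sup>2)"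
    unfolding power2_norm_eq_inner by (simp add: inner_diff_left inner_diff_right inner_commute algebra_simps)
  also have "\<dots> \<le> (norm \<Delta>)\<^sup>2 - \<eta> * (\<eta> * (norm N)\<^sup>2 + (1 / 2 - 251 / 10000) * (m * s) * (norm \<Delta>)\<^sup>2 - M / 2 * e\<^sup>2)
      + \<eta> * (\<eta> * (norm N)\<^sup>2)"
    using descent \<eta>_pos by (intro add_right_mono diff_left_mono mult_left_mono) auto
  \<comment> \<open>The decrease term cancels the squared step exactly; 4749/10000 is 1/2 -
    251/10000.\<close>
  also have "\<dots> = (norm \<Delta>)\<^sup>2 - (\<eta> * 4749 / 10000) * (m * s * (norm \<Delta>)\<^sup>2) + \<eta> / 2 * (M * e\<^sup>2)"
    by (simp add: algebra_simps)
  also have "\<dots> \<le> (norm \<Delta>)\<^sup>2 - (1 / (64 * D Xs)) * (m * s * (norm \<Delta>)\<^sup>2) + (1 / (28 * D Xs)) * (M * e\<^sup>2)"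
  proof (intro add_mono diff_left_mono mult_right_mono)
    show "1 / (64 * D Xs) \<le> \<eta> * 4749 / 10000"
      using D0 D0_pos Ds_pos by (simp add: \<eta>_def field_simps)
    show "\<eta> / 2 \<le> 1 / (28 * D Xs)"
      using D0 D0_pos Ds_pos by (simp add: \<eta>_def field_simps)
  qed (use mpos Mpos s in auto)
  finally have main: "(Dist Up Usr)\<^sup>2 \<le>
      (1 - m * s / (64 * D Xs)) * (Dist U Usr)\<^sup>2 + M / (28 * D Xs) * (norm (Xs - Xsr))\<^sup>2"
    by (simp add: dist e_def algebra_simps)
  \<comment> \<open>At the boundary radius the contraction gains
    \<open>m * s * \<rho>\<^sup>2 / (64 * D Xs)\<close>. The truncation error costs less, since
    \<open>4 * (M * e\<^sup>2)\<close> \<le> \<open>m * s * \<rho>\<^sup>2\<close> while the factor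
    64/28 would do.\<close>
  have stay: "Dist Up Usr \<le> \<rho>"
  proof (rule power2_le_imp_le)
    have "m * s \<le> 64 * D Xs" using Ds mult_right_mono[OF \<open>m \<le> M\<close> less_imp_le[OF s(1)]] Ds_pos by linarith
    then have \<alpha>: "0 \<le> 1 - m * s / (64 * D Xs)" using Ds_pos by simp
    have "(Dist U Usr)\<^sup>2 \<le> \<rho>\<^sup>2" using U_\<rho> dist by (intro power_mono) auto
    then have 1: "(1 - m * s / (64 * D Xs)) * (Dist U Usr)\<^sup>2 \<le> (1 - m * s / (64 * D Xs)) * \<rho>\<^sup>2"
      using \<alpha> by (intro mult_left_mono)
    have \<rho>2: "m * s * \<rho>\<^sup>2 = 4 * (M * (\<tau> ^ 3 / 40000 * (s / L)\<^sup>2 * s\<^sup>2))"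
    proof -
      have "\<rho>\<^sup>2 = (\<tau> / 100 * (s / L))\<^sup>2 * s" unfolding \<rho> using s by (simp only: power_mult_distrib real_sqrt_pow2 less_imp_le)
      then show ?thesis by (simp add: m power2_eq_square power3_eq_cube)
    qed
    have "M * e\<^sup>2 \<le> M * (\<tau> ^ 3 / 40000 * (s / L)\<^sup>2 * s\<^sup>2)"
      using Mpos e_sq by (intro mult_left_mono) auto
    then have "4 * (M * e\<^sup>2) \<le> m * s * \<rho>\<^sup>2" using \<rho>2 by linarith
    moreover have "0 \<le> M * e\<^sup>2" using Mpos by simp
    ultimately have "64 * (M * e\<^sup>2) \<le> 28 * (m * s * \<rho>\<^sup>2)" by linarith
    then have "M * e\<^sup>2 / (28 * D Xs) \<le> m * s * \<rho>\<^sup>2 / (64 * D Xs)"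
      using Ds_pos by (simp add: divide_le_eq le_divide_eq mult_ac)
    then show "(Dist Up Usr)\<^sup>2 \<le> \<rho>\<^sup>2"
      using main 1 by (simp add: e_def algebra_simps)
  qed (use \<rho>_pos in simp)
  show ?thesis
    using main stay unfolding Let_def Up_def G_def X_def \<eta>_def X0_def D_def \<rho>_def sigma by blast
qed

end
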